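(* Let $\Gamma$ be a nonbipartite distance-regular graph with diameter $d\ge 3$, valency $k$ and intersection numbers $b_i, c_i$. Let $\sigma_0,\sigma_1,\ldots,\sigma_d,\varepsilon,h$ be complex scalars, and write $\sigma=\sigma_1$. Then the following are equivalent. (i) $\Gamma$ is tight, $\sigma_0,\sigma_1,\ldots,\sigma_d$ is a feasible cosine sequence for $\Gamma$, $\varepsilon$ is the auxiliary parameter of $\Gamma$ associated with the corresponding eigenvalue, and $$h=\frac{(1-\sigma)(1-\sigma_2)}{(\sigma^2-\sigma_2)(1-\varepsilon\sigma)}.$$ (ii) $\sigma_0=1$, $\sigma_{d-1}=\sigma\sigma_d$, $\varepsilon\ne -1$, $$k=h\,\frac{\sigma-\varepsilon}{\sigma-1},$$ $$b_i=h\,\frac{(\sigma_{i-1}-\sigma\sigma_i)(\sigma_{i+1}-\varepsilon\sigma_i)}{(\sigma_{i-1}-\sigma_{i+1})(\sigma_{i+1}-\sigma_i)}\qquad(1\le i\le d-1),$$ $$c_i=h\,\frac{(\sigma_{i+1}-\sigma\sigma_i)(\sigma_{i-1}-\varepsilon\sigma_i)}{(\sigma_{i+1}-\sigma_{i-1})(\sigma_{i-1}-\sigma_i)}\qquad(1\le i\le d-1),$$ $$c_d=h\,\frac{\sigma-\varepsilon}{\sigma-1},$$ and the denominators in these four expressions are all nonzero.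
   Context: Graphs are finite, undirected, connected, without loops or multiple edges. For a graph $\Gamma=(X,R)$ with vertex set $X$, edge set $R$, path-length distance $\partial$ and diameter $d=\max\{\partial(x,y): x,y\in X\}$, put $\Gamma_i(x)=\{y\in X:\partial(x,y)=i\}$. $\Gamma$ is distance-regular if for all $0\le h,i,j\le d$ and all $x,y\in X$ with $\partial(x,y)=h$ the number $p^h_{ij}=|\Gamma_i(x)\cap\Gamma_j(y)|$ does not depend on $x,y$. Then $c_i=p^i_{1,i-1}$ $(1\le i\le d)$, $a_i=p^i_{1i}$ $(0\le i\le d)$, $b_i=p^i_{1,i+1}$ $(0\le i\le d-1)$, $c_0=0$, $b_d=0$, and $k=b_0$ is the valency. The eigenvalues of $\Gamma$ are the distinct eigenvalues of its adjacency matrix; there are exactly $d+1$ of them, all real, $\theta_0>\theta_1>\cdots>\theta_d$, with $\theta_0=k$. $\Gamma$ is bipartite iff $a_i=0$ for $0\le i\le d$. For an eigenvalue $\theta$ with multiplicity $m$, let $E$ be the matrix of the orthogonal projection of $\mathbb{R}^X$ onto the $\theta$-eigenspace. The cosine sequence $\sigma_0,\ldots,\sigma_d$ of $\theta$ is defined by $E=|X|^{-1}m\sum_{i=0}^d\sigma_iA_i$, where $A_i$ is the $i$th distance matrix (entry $1$ at $(x,y)$ if $\partial(x,y)=i$, else $0$). Equivalently, $\sigma_0=1$ and $c_i\sigma_{i-1}+a_i\sigma_i+b_i\sigma_{i+1}=\theta\sigma_i$ for $0\le i\le d$ (terms with $\sigma_{-1},\sigma_{d+1}$ vanish). $\Gamma$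 (with $d\ge3$) is tight if it is not bipartite and $\left(\theta_1+\frac{k}{a_1+1}\right)\left(\theta_d+\frac{k}{a_1+1}\right)=-\frac{ka_1b_1}{(a_1+1)^2}$. For $\Gamma$ tight and $\theta\in\{\theta_1,\theta_d\}$ with complement $\theta'$ in $\{\theta_1,\theta_d\}$, the auxiliary parameter of $\Gamma$ associated with $\theta$ is $\varepsilon=\dfrac{k^2-\theta\theta'}{k(\theta-\theta')}$. For $\Gamma$ tight, a cosine sequence $\sigma_0,\ldots,\sigma_d$ of $\Gamma$ (or its eigenvalue $\theta$) is feasible if $\theta\in\{\theta_1,\theta_d\}$ and $\sigma_{i-1}\neq\sigma_{i+1}$ for $1\le i\le d-1$. *)

theory Defs
  imports
    "HOL-Analysis.Analysis"
    "Graph_Theory.Graph_Theory"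
begin

text \<open>
  The locale predicate \<^term>\<open>graph G\<close> of the entry Graph\_Theory describes a finite digraph without
  loops and parallel arcs whose arc relation is symmetric, i.e. a finite simple undirected graph.
  The plain name of its connectedness predicate clashes with topological connectedness, hence the
  qualified name below.
\<close>

definition graph_dist :: "('v, 'e) pre_digraph \<Rightarrow> 'v \<Rightarrow> 'v \<Rightarrow> nat" where
  "graph_dist G x y = (LEAST n. \<exists>p. pre_digraph.awalk G x p y \<and> length p = n)"

definition graph_diameter :: "('v, 'e) pre_digraph \<Rightarrow> nat" where
  "graph_diameter G = Max {graph_dist G x y | x y. x \<in> verts G \<and> y \<in> verts G}"

definition dist_sphere :: "('v, 'e) pre_digraph \<Rightarrow> nat \<Rightarrow> 'v \<Rightarrow> 'v set" where
  "dist_sphere G i x = {y \<in> verts G. graph_dist G x y = i}"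

definition distance_regular :: "('v, 'e) pre_digraph \<Rightarrow> bool" where
  "distance_regular G \<longleftrightarrow> graph G \<and> Digraph_Component.connected G \<and>
     (\<forall>h\<le>graph_diameter G. \<forall>i\<le>graph_diameter G. \<forall>j\<le>graph_diameter G.
        \<exists>p. \<forall>x\<in>verts G. \<forall>y\<in>verts G. graph_dist G x y = h \<longrightarrow>
          card (dist_sphere G i x \<inter> dist_sphere G j y) = p)"

text \<open>Well defined for distance-regular \<open>G\<close> and \<open>h, i, j\<close> at most the diameter.\<close>

definition intersection_number :: "('v, 'e) pre_digraph \<Rightarrow> nat \<Rightarrow> nat \<Rightarrow> nat \<Rightarrow> nat" where
  "intersection_number G h i j =
     (THE p. \<forall>x\<in>verts G. \<forall>y\<in>verts G. graph_dist G x y = h \<longrightarrow>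
        card (dist_sphere G i x \<inter> dist_sphere G j y) = p)"

definition c_num :: "('v, 'e) pre_digraph \<Rightarrow> nat \<Rightarrow> nat" where
  "c_num G i = (if i = 0 then 0 else intersection_number G i 1 (i - 1))"

definition a_num :: "('v, 'e) pre_digraph \<Rightarrow> nat \<Rightarrow> nat" where
  "a_num G i = intersection_number G i 1 i"

definition b_num :: "('v, 'e) pre_digraph \<Rightarrow> nat \<Rightarrow> nat" where
  "b_num G i = (if i < graph_diameter G then intersection_number G i 1 (i + 1) else 0)"

definition valency :: "('v, 'e) pre_digraph \<Rightarrow> nat" where
  "valency G = b_num G 0"

text \<open>For distance-regular graphs only: no odd cycles iff all \<open>a\<^sub>i\<close> vanish.\<close>

definition drg_bipartite :: "('v, 'e) pre_digraph \<Rightarrow> bool" where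
  "drg_bipartite G \<longleftrightarrow> (\<forall>i\<le>graph_diameter G. a_num G i = 0)"

text \<open>
  Matrices are indexed by the vertex type, so the notions below are meant for
  \<^term>\<open>verts G = UNIV\<close>.
\<close>

definition distance_matrix :: "('v::finite, 'e) pre_digraph \<Rightarrow> nat \<Rightarrow> real^'v^'v" where
  "distance_matrix G i = (\<chi> x y. if graph_dist G x y = i then 1 else 0)"

definition adjacency_matrix :: "('v::finite, 'e) pre_digraph \<Rightarrow> real^'v^'v" where
  "adjacency_matrix G = (\<chi> x y. if x \<rightarrow>\<^bsub>G\<^esub> y then 1 else 0)"

definition eigenspace :: "('v::finite, 'e) pre_digraph \<Rightarrow> real \<Rightarrow> (real^'v) set" where
  "eigenspace G \<theta> = {v. adjacency_matrix G *v v = \<theta> *\<^sub>R v}"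

definition eigenvalues :: "('v::finite, 'e) pre_digraph \<Rightarrow> real set" where
  "eigenvalues G = {\<theta>. \<exists>v. v \<noteq> 0 \<and> adjacency_matrix G *v v = \<theta> *\<^sub>R v}"

definition multiplicity_of :: "('v::finite, 'e) pre_digraph \<Rightarrow> real \<Rightarrow> nat" where
  "multiplicity_of G \<theta> = dim (eigenspace G \<theta>)"

text \<open>The distinct eigenvalues in decreasing order, numbered from 0.\<close>

definition nth_eigenvalue :: "('v::finite, 'e) pre_digraph \<Rightarrow> nat \<Rightarrow> real" where
  "nth_eigenvalue G i = rev (sorted_list_of_set (eigenvalues G)) ! i"

definition orthogonal_projection_matrix :: "real^'v^'v \<Rightarrow> (real^'v::finite) set \<Rightarrow> bool" where
  "orthogonal_projection_matrix E S \<longleftrightarrow>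
     (\<forall>v. E *v v \<in> S \<and> (\<forall>w\<in>S. orthogonal (v - E *v v) w))"

text \<open>Only the values \<open>s 0, \<dots>, s d\<close> matter, where \<open>d\<close> is the diameter.\<close>

definition cosine_sequence ::
    "('v::finite, 'e) pre_digraph \<Rightarrow> real \<Rightarrow> (nat \<Rightarrow> real) \<Rightarrow> bool" where
  "cosine_sequence G \<theta> s \<longleftrightarrow> \<theta> \<in> eigenvalues G \<and>
     (\<exists>E. orthogonal_projection_matrix E (eigenspace G \<theta>) \<and>
          E = (real (multiplicity_of G \<theta>) / real (card (verts G))) *\<^sub>R
                (\<Sum>i\<le>graph_diameter G. s i *\<^sub>R distance_matrix G i))"

definition tight :: "('v::finite, 'e) pre_digraph \<Rightarrow> bool" where
  "tight G \<longleftrightarrow> distance_regular G \<and> graph_diameter G \<ge> 3 \<and> \<not> drg_bipartite G \<and>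
     (let k = real (valency G); a1 = real (a_num G 1); b1 = real (b_num G 1);
          \<theta>1 = nth_eigenvalue G 1; \<theta>d = nth_eigenvalue G (graph_diameter G)
      in (\<theta>1 + k / (a1 + 1)) * (\<theta>d + k / (a1 + 1)) = - (k * a1 * b1) / (a1 + 1)\<^sup>2)"

definition complementary_eigenvalue :: "('v::finite, 'e) pre_digraph \<Rightarrow> real \<Rightarrow> real" where
  "complementary_eigenvalue G \<theta> =
     (if \<theta> = nth_eigenvalue G 1 then nth_eigenvalue G (graph_diameter G) else nth_eigenvalue G 1)"

definition auxiliary_parameter :: "('v::finite, 'e) pre_digraph \<Rightarrow> real \<Rightarrow> real" where
  "auxiliary_parameter G \<theta> =
     (let k = real (valency G); \<theta>' = complementary_eigenvalue G \<theta>
      in (k\<^sup>2 - \<theta> * \<theta>') / (k * (\<theta> - \<theta>')))"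

definition feasible_cosine_sequence ::
    "('v::finite, 'e) pre_digraph \<Rightarrow> real \<Rightarrow> (nat \<Rightarrow> real) \<Rightarrow> bool" where
  "feasible_cosine_sequence G \<theta> s \<longleftrightarrow> tight G \<and> cosine_sequence G \<theta> s \<and>
     \<theta> \<in> {nth_eigenvalue G 1, nth_eigenvalue G (graph_diameter G)} \<and>
     (\<forall>i\<in>{1..graph_diameter G - 1}. s (i - 1) \<noteq> s (i + 1))"

end

theory Submission
  imports Defs
begin

text \<open>
  Both directions compare two eigenvalues \<open>\<theta> = k s\<^sub>1\<close> and \<open>\<theta>' = k r\<^sub>1\<close> with cosine sequences \<open>s\<close> and
  \<open>r\<close> through the cross relation

  \<open>(s\<^sub>1 - r\<^sub>1) (s\<^sub>i\<^sub>+\<^sub>1 r\<^sub>i\<^sub>+\<^sub>1 - s\<^sub>i r\<^sub>i) = (1 - s\<^sub>1 r\<^sub>1) (s\<^sub>i r\<^sub>i\<^sub>+\<^sub>1 - s\<^sub>i\<^sub>+\<^sub>1 r\<^sub>i)\<close>,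

  in which \<open>\<epsilon> = (1 - s\<^sub>1 r\<^sub>1) / (s\<^sub>1 - r\<^sub>1)\<close> is the auxiliary parameter.

  \<^bold>\<open>Why a tight graph satisfies it.\<close> A cosine sequence \<open>u\<close> of an eigenvalue makes the matrix with entries
  \<open>u (dist x y)\<close> a positive multiple of an orthogonal projection. Its quadratic form, evaluated
  on the sum of the common neighbours of an edge \<open>xy\<close> minus a suitable multiple of \<open>x + y\<close>, is a
  positive multiple of the Gram determinant of the projections of \<open>x\<close>, \<open>y\<close> and that sum. It is affine in the number of edges among the
  common neighbours. The second largest and the least eigenvalue bound that number from opposite
  sides, and eliminating it gives the fundamental bound (\<open>tight_form_nonneg\<close>); tightness is
  equality. In a tight graph the quadratic form vanishes for both eigenvalues, so the projected
  vectors are dependent, and counting common neighbours of \<open>xy\<close> at distance \<open>i\<close> from a vertex \<open>p\<close>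
  with the two sequences gives the same number twice. That is the cross relation
  (\<open>tight_cosine_relation\<close>).

  \<^bold>\<open>From the relation to the formulas.\<close> The relation expresses \<open>r\<^sub>i\<^sub>\<plusminus>\<^sub>1 / r\<^sub>i\<close> through \<open>s\<close> and \<open>\<epsilon>\<close>, so the
  three-term recurrences of \<open>s\<close> and \<open>r\<close> at \<open>i\<close> are two linear equations for \<open>b\<^sub>i\<close> and \<open>c\<^sub>i\<close>, with the
  stated solution and \<open>h = k (s\<^sub>1 - r\<^sub>1) / (1 + s\<^sub>1)\<close>. At \<open>i = d\<close> they force \<open>c\<^sub>d = k\<close>. The other
  expression for \<open>h\<close> is the equation \<open>c\<^sub>1 = 1\<close>.

  \<^bold>\<open>From the formulas to tightness.\<close> The formulas make \<open>\<sigma>\<close> satisfy a three-term recurrence, and the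
  sequence \<open>\<rho>\<close> defined from \<open>\<sigma>\<close> and \<open>\<epsilon>\<close> by the cross relation satisfies one as well
  (\<open>parameters_sequences\<close>). Since the adjacency matrix is symmetric, both sequences are real and
  belong to eigenvalues. The relation at \<open>i = 1\<close> says that these two eigenvalues satisfy the tightness
  equation. Any two eigenvalues other than \<open>k\<close> lie between the least and the second largest one, so
  the fundamental bound leaves room only if they are these two (\<open>extremal_pair\<close>).
\<close>

section \<open>The path metric\<close>

locale drg =
  fixes G :: "('v::finite, 'e) pre_digraph"
  assumes verts_UNIV: "verts G = UNIV"
    and dist_regular: "distance_regular G"
    and diam_ge_2: "2 \<le> graph_diameter G"
begin

abbreviation D :: "'v \<Rightarrow> 'v \<Rightarrow> nat" where "D \<equiv> graph_dist G"
abbreviation d :: nat where "d \<equiv> graph_diameter G"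

lemma is_graph: "graph G"
  using dist_regular by (simp add: distance_regular_def)

text \<open>
  Powers of the arc relation replace walks from here on: reversal, concatenation and prefixes of walks
  become facts about relations.
\<close>

lemma awalk_iff_relpow:
  "(\<exists>p. pre_digraph.awalk G x p y \<and> length p = n) \<longleftrightarrow> (x, y) \<in> arcs_ends G ^^ n"
proof -
  interpret graph G by (rule is_graph)
  show ?thesis
  proof (induction n arbitrary: x)
    case 0
    show ?case by (simp add: awalk_Nil_iff verts_UNIV)
  next
    case (Suc n)
    have "(\<exists>p. awalk x p y \<and> length p = Suc n) \<longleftrightarrow>
        (\<exists>e q. awalk x (e # q) y \<and> length q = n)"
      by (metis length_Suc_conv)
    also have "\<dots> \<longleftrightarrow>
        (\<exists>e\<in>arcs G. tail G e = x \<and> (\<exists>q. awalk (head G e) q y \<and> length q = n))"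
      unfolding awalk_Cons_iff by blast
    also have "\<dots> \<longleftrightarrow> (\<exists>z. (x, z) \<in> arcs_ends G \<and> (z, y) \<in> arcs_ends G ^^ n)"
      unfolding Suc.IH arcs_ends_conv by auto
    also have "\<dots> \<longleftrightarrow> (x, y) \<in> arcs_ends G ^^ Suc n"
      by (meson relpow_Suc_D2 relpow_Suc_I2)
    finally show ?case .
  qed
qed

lemma graph_dist_eq_Least: "D x y = (LEAST n. (x, y) \<in> arcs_ends G ^^ n)"
  unfolding graph_dist_def awalk_iff_relpow ..

lemma relpow_graph_dist: "(x, y) \<in> arcs_ends G ^^ D x y"
proof -
  interpret graph G by (rule is_graph)
  have "strongly_connected G"
    using dist_regular symmetric_connected_imp_strongly_connected[OF sym_arcs] by (simp add: distance_regular_def)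
  then have "(x, y) \<in> (arcs_ends G)\<^sup>*"
    by (auto simp: strongly_connected_def verts_UNIV intro: reachable_rtranclI)
  then obtain n where "(x, y) \<in> arcs_ends G ^^ n"
    using rtrancl_imp_relpow by blast
  then show ?thesis
    unfolding graph_dist_eq_Least by (rule LeastI[of "\<lambda>n. (x, y) \<in> arcs_ends G ^^ n"])
qed

lemma graph_dist_le: "(x, y) \<in> arcs_ends G ^^ n \<Longrightarrow> D x y \<le> n"
  unfolding graph_dist_eq_Least by (rule Least_le)

lemma dist_commute: "D x y = D y x"
proof -
  have *: "(y, x) \<in> arcs_ends G ^^ n" if "(x, y) \<in> arcs_ends G ^^ n" for n x y
    using that
  proof (induction n arbitrary: x)
    case (Suc n)
    then obtain z where z: "(x, z) \<in> arcs_ends G" "(z, y) \<in> arcs_ends G ^^ n"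
      by (meson relpow_Suc_D2)
    interpret graph G by (rule is_graph)
    have zx: "(z, x) \<in> arcs_ends G"
      by (rule arcs_ends_symmetric[OF sym_arcs z(1)])
    show ?case by (rule relpow_Suc_I[OF Suc.IH[OF z(2)] zx])
  qed auto
  show ?thesis
    by (rule antisym[OF graph_dist_le[OF *[OF relpow_graph_dist]] graph_dist_le[OF *[OF relpow_graph_dist]]])
qed

lemma dist_0_iff [simp]: "D x y = 0 \<longleftrightarrow> x = y"
proof
  assume "D x y = 0"
  then show "x = y" using relpow_graph_dist[of x y] by simp
next
  assume "x = y"
  then show "D x y = 0" using graph_dist_le[of x y 0] by simp
qed

lemma dist_self [simp]: "D x x = 0"
  by simp

lemma dist_1_iff: "D x y = 1 \<longleftrightarrow> (x, y) \<in> arcs_ends G"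
proof
  assume "D x y = 1"
  then show "(x, y) \<in> arcs_ends G" using relpow_graph_dist[of x y] by simp
next
  interpret graph G by (rule is_graph)
  assume *: "(x, y) \<in> arcs_ends G"
  then have "x \<noteq> y" using adj_not_same by blast
  then show "D x y = 1" using graph_dist_le[of x y 1] * dist_0_iff[of x y] unfolding relpow_1 by linarith
qed

lemma dist_triangle: "D x z \<le> D x y + D y z"
proof -
  have "(x, z) \<in> arcs_ends G ^^ (D x y + D y z)"
    unfolding relpow_add by (rule relcompI[OF relpow_graph_dist relpow_graph_dist])
  then show ?thesis by (rule graph_dist_le)
qed

lemma step_towards:
  assumes "D x y = Suc n"
  obtains z where "D x z = 1" "D z y = n"
proof -
  obtain z where z: "(x, z) \<in> arcs_ends G" "(z, y) \<in> arcs_ends G ^^ n"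
    using relpow_graph_dist[of x y] assms by (metis relpow_Suc_D2)
  then have "D x z = 1" "D z y \<le> n"
    using dist_1_iff graph_dist_le by auto
  moreover have "D x y \<le> D x z + D z y" by (rule dist_triangle)
  ultimately have "D z y = n" using assms by linarith
  then show ?thesis using that \<open>D x z = 1\<close> by blast
qed

lemma finite_dists: "finite {D x y | x y. x \<in> verts G \<and> y \<in> verts G}"
proof -
  have "{D x y | x y. x \<in> verts G \<and> y \<in> verts G} = (\<lambda>(x, y). D x y) ` UNIV"
    by (auto simp: verts_UNIV)
  then show ?thesis by simp
qed

lemma dist_le_d: "D x y \<le> d"
  unfolding graph_diameter_def using finite_dists by (intro Max_ge) (auto simp: verts_UNIV)

text \<open>
  A shortest walk from a vertex to one at distance \<open>d\<close> passes through every smaller distance.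
\<close>

lemma dist_attained:
  assumes "i \<le> d"
  obtains x y where "D x y = i"
proof -
  have "d \<in> {D x y | x y. x \<in> verts G \<and> y \<in> verts G}"
    unfolding graph_diameter_def using finite_dists by (intro Max_in) (auto simp: verts_UNIV)
  then have "\<exists>x y. d = D x y" by blast
  then obtain x y where xy: "d = D x y" by blast
  have "\<exists>x. D x y = d - n" for n
  proof (induction n)
    case 0
    show ?case using xy by (metis diff_zero)
  next
    case (Suc n)
    then obtain x where x: "D x y = d - n" by blast
    show ?case
    proof (cases "d - n")
      case 0
      then have "D y y = d - Suc n" by simp
      then show ?thesis by blast
    next
      case (Suc m)
      then obtain z where "D z y = m" using step_towards[of x y m] x by auto
      then have "D z y = d - Suc n" using Suc by simp
      then show ?thesis by blast
    qed
  qed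
  from this[of "d - i"] show ?thesis using assms that by auto
qed

lemma dist_adj_cases:
  assumes "D x z = 1"
  shows "D z y = D x y \<or> D z y = Suc (D x y) \<or> Suc (D z y) = D x y"
  using assms dist_triangle[of x y z] dist_triangle[of z y x] dist_commute[of x z] by linarith

section \<open>Intersection numbers\<close>

lemma card_intersection:
  assumes "i \<le> d" "j \<le> d"
  shows "card {z. D x z = i \<and> D z y = j} = intersection_number G (D x y) i j"
proof -
  have "\<exists>p. \<forall>x\<in>verts G. \<forall>y\<in>verts G. graph_dist G x y = h \<longrightarrow>
          card (dist_sphere G i x \<inter> dist_sphere G j y) = p" if "h \<le> d" for h
    using dist_regular assms that unfolding distance_regular_def by blast
  from this[OF dist_le_d[of x y]] obtain p where p: "\<And>x' y'. D x' y' = D x y \<Longrightarrow>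
          card (dist_sphere G i x' \<inter> dist_sphere G j y') = p"
    by (auto simp: verts_UNIV)
  have "intersection_number G (D x y) i j = p"
    unfolding intersection_number_def
  proof (rule the_equality)
    show "\<forall>x'\<in>verts G. \<forall>y'\<in>verts G. D x' y' = D x y \<longrightarrow>
        card (dist_sphere G i x' \<inter> dist_sphere G j y') = p"
      using p by blast
  next
    fix q assume "\<forall>x'\<in>verts G. \<forall>y'\<in>verts G. D x' y' = D x y \<longrightarrow>
        card (dist_sphere G i x' \<inter> dist_sphere G j y') = q"
    then show "q = p" using p[of x y] by (auto simp: verts_UNIV)
  qed
  moreover have "{z. D x z = i \<and> D z y = j} = dist_sphere G i x \<inter> dist_sphere G j y"
    using dist_commute by (auto simp: dist_sphere_def verts_UNIV)
  ultimately show ?thesis using p[of x y] by simp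
qed

lemma card_c:
  assumes "0 < D x y"
  shows "card {z. D x z = 1 \<and> Suc (D z y) = D x y} = c_num G (D x y)"
proof -
  have "{z. D x z = 1 \<and> Suc (D z y) = D x y} = {z. D x z = 1 \<and> D z y = D x y - 1}"
    using assms by auto
  then show ?thesis
    using card_intersection[of 1 "D x y - 1" x y] diam_ge_2 dist_le_d[of x y] assms
    by (simp add: c_num_def del: dist_0_iff)
qed

lemma card_a: "card {z. D x z = 1 \<and> D z y = D x y} = a_num G (D x y)"
  using card_intersection[of 1 "D x y" x y] diam_ge_2 dist_le_d[of x y]
  unfolding a_num_def by simp

lemma card_b: "card {z. D x z = 1 \<and> D z y = Suc (D x y)} = b_num G (D x y)"
proof (cases "D x y < d")
  case True
  then show ?thesis
    using card_intersection[of 1 "Suc (D x y)" x y] diam_ge_2 unfolding b_num_def by simp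
next
  case False
  then have "{z. D x z = 1 \<and> D z y = Suc (D x y)} = {}"
    using dist_le_d[of x y] dist_le_d[of _ y] by (auto, metis Suc_n_not_le_n)
  then show ?thesis using False unfolding b_num_def by (simp add: card_eq_0_iff)
qed

lemma c_0 [simp]: "c_num G 0 = 0" by (simp add: c_num_def)

lemma b_d [simp]: "b_num G d = 0" by (simp add: b_num_def)

lemma a_0 [simp]: "a_num G 0 = 0"
proof -
  have "{z. D x z = 1 \<and> D z x = D x x} = {}" for x by auto
  then show ?thesis using card_a[of undefined undefined] by (metis card.empty dist_self)
qed

lemma card_neighbours: "card {z. D x z = 1} = valency G"
proof -
  have "{z. D x z = 1 \<and> D z x = Suc (D x x)} = {z. D x z = 1}"
    using dist_commute by auto
  then show ?thesis using card_b[of x x] by (simp add: valency_def)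
qed

text \<open>
  Every action of the adjacency matrix on functions of the distance to a fixed vertex reduces to this
  splitting by distance classes.
\<close>

lemma sum_neighbours:
  fixes f :: "nat \<Rightarrow> 'a::comm_ring_1"
  shows "(\<Sum>z | D x z = 1. f (D z y)) =
     of_nat (c_num G (D x y)) * f (D x y - 1) + of_nat (a_num G (D x y)) * f (D x y)
     + of_nat (b_num G (D x y)) * f (Suc (D x y))"
proof -
  let ?C = "{z. D x z = 1 \<and> Suc (D z y) = D x y}"
  let ?A = "{z. D x z = 1 \<and> D z y = D x y}"
  let ?B = "{z. D x z = 1 \<and> D z y = Suc (D x y)}"
  have C: "card ?C = c_num G (D x y)"
    using card_c[of x y] by (cases "D x y = 0") auto
  have eq: "{z. D x z = 1} = ?C \<union> (?A \<union> ?B)"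
    using dist_adj_cases by blast
  have "(\<Sum>z | D x z = 1. f (D z y)) = (\<Sum>z\<in>?C. f (D z y)) + ((\<Sum>z\<in>?A. f (D z y)) + (\<Sum>z\<in>?B. f (D z y)))"
    unfolding eq by (subst sum.union_disjoint; (subst sum.union_disjoint)?; auto)
  also have "(\<Sum>z\<in>?C. f (D z y)) = (\<Sum>z\<in>?C. f (D x y - 1))"
    by (rule sum.cong, simp) (metis (mono_tags, lifting) diff_Suc_1 mem_Collect_eq)
  also have "(\<Sum>z\<in>?A. f (D z y)) = (\<Sum>z\<in>?A. f (D x y))"
    by (rule sum.cong) auto
  also have "(\<Sum>z\<in>?B. f (D z y)) = (\<Sum>z\<in>?B. f (Suc (D x y)))"
    by (rule sum.cong) auto
  finally show ?thesis by (simp only: sum_constant C card_a card_b add.assoc)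
qed

lemma cab_sum: "i \<le> d \<Longrightarrow> c_num G i + a_num G i + b_num G i = valency G"
proof -
  assume "i \<le> d"
  then obtain x y where xy: "D x y = i" by (rule dist_attained)
  have "int (valency G) = int (c_num G i + a_num G i + b_num G i)"
    using sum_neighbours[where f = "\<lambda>_. 1::int" and x = x and y = y] card_neighbours[of x] xy by simp
  then show ?thesis by linarith
qed

lemma c_pos: "\<lbrakk>0 < i; i \<le> d\<rbrakk> \<Longrightarrow> 0 < c_num G i"
proof -
  assume "0 < i" "i \<le> d"
  then obtain x y n where xy: "D x y = i" "i = Suc n"
    by (metis dist_attained gr0_conv_Suc)
  then obtain z where "D x z = 1" "D z y = n" using step_towards by metis
  then have "z \<in> {z. D x z = 1 \<and> Suc (D z y) = D x y}" using xy by simp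
  then show ?thesis using card_c[of x y] xy card_gt_0_iff[of "{z. D x z = 1 \<and> Suc (D z y) = D x y}"]
    by auto
qed

lemma b_pos: "i < d \<Longrightarrow> 0 < b_num G i"
proof -
  assume "i < d"
  then obtain y x where xy: "D y x = Suc i"
    by (metis dist_attained Suc_leI)
  then obtain z where z: "D y z = 1" "D z x = i" using step_towards by metis
  then have "y \<in> {y. D z y = 1 \<and> D y x = Suc (D z x)}" using xy dist_commute by simp
  then show ?thesis using card_b[of z x] z card_gt_0_iff[of "{y. D z y = 1 \<and> D y x = Suc (D z x)}"]
    by auto
qed

lemma c_1: "c_num G 1 = 1"
proof -
  obtain x y where xy: "D x y = 1" using dist_attained[of 1] diam_ge_2 by auto
  then have "{z. D x z = 1 \<and> Suc (D z y) = D x y} = {y}" by auto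
  then show ?thesis using card_c[of x y] xy by simp
qed

lemma valency_pos: "0 < valency G"
  using b_pos[of 0] diam_ge_2 by (simp add: valency_def)

end

section \<open>Symmetric matrices\<close>

lemma symmetric_matrix_inner:
  fixes A :: "real^'n^'n"
  assumes "transpose A = A"
  shows "(A *v v) \<bullet> w = v \<bullet> (A *v w)"
  by (metis assms dot_lmul_matrix transpose_matrix_vector)

text \<open>
  The maximum of the Rayleigh quotient over the compact unit sphere of \<open>S\<close> is attained, and it is
  attained at an eigenvector. The bound by \<open>\<theta>\<close> lets any test vector in \<open>S\<close> produce an eigenvalue at
  least as large as its own Rayleigh quotient.
\<close>

lemma symmetric_matrix_max_eigenvector:
  fixes A :: "real^'n^'n"
  assumes sym: "transpose A = A" and S: "subspace S" "S \<noteq> {0}"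
    and inv: "\<And>v. v \<in> S \<Longrightarrow> A *v v \<in> S"
  obtains v \<theta> where "v \<in> S" "norm v = 1" "A *v v = \<theta> *\<^sub>R v"
    "\<And>w. w \<in> S \<Longrightarrow> w \<bullet> (A *v w) \<le> \<theta> * (w \<bullet> w)"
proof -
  let ?K = "S \<inter> sphere 0 1"
  obtain u where u: "u \<in> S" "u \<noteq> 0" using S subspace_0 by blast
  have ne: "(1 / norm u) *\<^sub>R u \<in> ?K" using u S(1) by (simp add: subspace_scale)
  have cpt: "compact ?K" using S(1) by (simp add: closed_Int_compact closed_subspace)
  have cont: "continuous_on ?K (\<lambda>v. v \<bullet> (A *v v))"
    by (intro continuous_intros linear_continuous_on) (simp add: linear_conv_bounded_linear[symmetric])
  obtain v where v: "v \<in> ?K" and max: "\<And>w. w \<in> ?K \<Longrightarrow> w \<bullet> (A *v w) \<le> v \<bullet> (A *v v)"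
    using continuous_attains_sup[OF cpt _ cont] ne by blast
  define \<theta> where "\<theta> = v \<bullet> (A *v v)"
  define q where "q w = \<theta> * (w \<bullet> w) - w \<bullet> (A *v w)" for w
  have nonneg: "0 \<le> q w" if w: "w \<in> S" for w
  proof (cases "w = 0")
    case False
    let ?w = "(1 / norm w) *\<^sub>R w"
    have "?w \<in> ?K" using w S(1) False by (simp add: subspace_scale)
    then have "?w \<bullet> (A *v ?w) \<le> \<theta>" unfolding \<theta>_def by (rule max)
    then have "(w \<bullet> (A *v w)) / (norm w)\<^sup>2 \<le> \<theta>"
      by (simp add: matrix_vector_mult_scaleR power2_eq_square)
    then show ?thesis using False by (simp add: q_def divide_le_eq power2_norm_eq_inner)
  qed (simp add: q_def)
  have vv: "v \<bullet> v = 1" using v by (simp add: norm_eq_1)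
  define r where "r = A *v v - \<theta> *\<^sub>R v"
  have r: "r \<in> S" unfolding r_def using v inv S(1) by (simp add: subspace_diff subspace_scale)
  \<comment> \<open>\<open>v\<close> minimises \<open>q \<ge> 0\<close> with \<open>q v = 0\<close>, so the first variation of \<open>q\<close> at \<open>v\<close> must vanish;
    in the direction of the residual \<open>r\<close> it is \<open>- 2 (r \<bullet> r)\<close>.\<close>
  have expand: "q (v + t *\<^sub>R r) = t\<^sup>2 * q r - 2 * t * (r \<bullet> r)" for t
  proof -
    have "A *v v = r + \<theta> *\<^sub>R v" by (simp add: r_def)
    then have Av: "r \<bullet> (A *v v) = r \<bullet> r + \<theta> * (v \<bullet> r)"
      by (simp add: inner_add_right inner_commute)
    moreover have Ar: "v \<bullet> (A *v r) = r \<bullet> r + \<theta> * (v \<bullet> r)"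
      using symmetric_matrix_inner[OF sym, of v r] Av by (simp add: inner_commute)
    ultimately show ?thesis using vv
      by (simp add: q_def \<theta>_def[symmetric] matrix_vector_right_distrib matrix_vector_mult_scaleR
          inner_add_left inner_add_right inner_commute[of r v] algebra_simps power2_eq_square)
  qed
  have "r \<bullet> r = 0"
  proof (rule ccontr)
    assume "r \<bullet> r \<noteq> 0"
    then have pos: "r \<bullet> r > 0" by simp
    have le: "0 \<le> t\<^sup>2 * q r - 2 * t * (r \<bullet> r)" for t
      unfolding expand[symmetric] using v r S(1) by (intro nonneg) (simp add: subspace_add subspace_scale)
    have "q r \<noteq> 0" using le[of 1] pos unfolding power_one by linarith
    then have "q r > 0" using nonneg[OF r] by simp
    then have "0 < (r \<bullet> r) * (r \<bullet> r) / q r" using pos by (intro divide_pos_pos mult_pos_pos)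
    moreover have "((r \<bullet> r) / q r)\<^sup>2 * q r = (r \<bullet> r) * (r \<bullet> r) / q r"
      using \<open>q r > 0\<close> by (simp add: power2_eq_square)
    moreover have "2 * ((r \<bullet> r) / q r) * (r \<bullet> r) = 2 * ((r \<bullet> r) * (r \<bullet> r) / q r)" by simp
    ultimately show False using le[of "(r \<bullet> r) / q r"] by linarith
  qed
  then have "A *v v = \<theta> *\<^sub>R v" by (simp add: r_def)
  moreover have "w \<bullet> (A *v w) \<le> \<theta> * (w \<bullet> w)" if "w \<in> S" for w
    using nonneg[OF that] by (simp add: q_def)
  ultimately show ?thesis using that[of v \<theta>] v by simp
qed

text \<open>
  The orthogonal complement of all eigenvectors is invariant, so if it were nonzero it would contain
  an eigenvector of its own.
\<close>

lemma symmetric_matrix_eigenvectors_span: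
  fixes A :: "real^'n^'n"
  assumes sym: "transpose A = A"
  shows "span {v. \<exists>\<theta>. A *v v = \<theta> *\<^sub>R v} = UNIV"
proof (rule ccontr)
  let ?V = "{v. \<exists>\<theta>. A *v v = \<theta> *\<^sub>R v}"
  let ?S = "{w. \<forall>v\<in>?V. v \<bullet> w = 0}"
  assume "span ?V \<noteq> UNIV"
  then have "span ?V \<subset> span UNIV" by auto
  then obtain y where y: "y \<noteq> 0" "y \<in> span UNIV" "\<And>x. x \<in> span ?V \<Longrightarrow> orthogonal y x"
    by (rule orthogonal_to_subspace_exists_gen) (rule that)
  have S: "subspace ?S" by (auto simp: subspace_def inner_add_right)
  have "v \<bullet> y = 0" if "v \<in> ?V" for v
    using y(3)[OF span_base[OF that]] by (simp add: orthogonal_def inner_commute)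
  then have yS: "y \<in> ?S" by simp
  then have S0: "?S \<noteq> {0}" using y(1) by blast
  have inv: "A *v w \<in> ?S" if "w \<in> ?S" for w
  proof (clarsimp)
    fix v \<theta> assume v: "A *v v = \<theta> *\<^sub>R v"
    then have "v \<bullet> w = 0" using that by blast
    then show "v \<bullet> (A *v w) = 0" using symmetric_matrix_inner[OF sym, of v w] v by simp
  qed
  obtain v \<theta> where v: "v \<in> ?S" "norm v = 1" "A *v v = \<theta> *\<^sub>R v"
    "\<And>w. w \<in> ?S \<Longrightarrow> w \<bullet> (A *v w) \<le> \<theta> * (w \<bullet> w)"
    by (rule symmetric_matrix_max_eigenvector[OF sym S S0 inv]) (assumption | rule that)+
  from v(3) have "v \<in> ?V" by blast
  with v(1) have "v \<bullet> v = 0" by blast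
  then show False using v(2) by simp
qed

text \<open>
  In an orthonormal basis \<open>B\<close> of \<open>S\<close> the diagonal entries of \<open>E\<close> are the sums of \<open>b\<^sub>i\<^sup>2\<close> over \<open>b \<in> B\<close>. This
  ties the multiplicity in the definition of a cosine sequence to its value at 0.
\<close>

lemma trace_orthogonal_projection:
  fixes E :: "real^'n^'n"
  assumes E: "orthogonal_projection_matrix E S" and S: "subspace S"
  shows "(\<Sum>i\<in>UNIV. E $ i $ i) = dim S"
proof -
  obtain B where B: "B \<subseteq> S" "pairwise orthogonal B" "\<And>x. x \<in> B \<Longrightarrow> norm x = 1"
    "independent B" "card B = dim S" "span B = S"
    using orthonormal_basis_subspace[OF S] by metis
  have fin: "finite B" using B(4) independent_imp_finite by blast
  have expand: "E *v v = (\<Sum>b\<in>B. (b \<bullet> v) *\<^sub>R b)" for v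
  proof -
    have "E *v v \<in> span B" using E B(6) by (simp add: orthogonal_projection_matrix_def)
    then have "E *v v = (\<Sum>b\<in>B. (b \<bullet> (E *v v)) *\<^sub>R b)"
      using orthonormal_basis_expand[OF B(2) B(3) _ fin, of "E *v v"]
      unfolding inner_commute[of "E *v v"] by simp
    moreover have "b \<bullet> (E *v v) = b \<bullet> v" if "b \<in> B" for b
    proof -
      have "orthogonal (v - E *v v) b"
        using E B(1) that by (auto simp: orthogonal_projection_matrix_def)
      then show ?thesis by (simp add: orthogonal_def inner_diff_left inner_commute[of b])
    qed
    ultimately show ?thesis by simp
  qed
  have "E $ i $ i = (\<Sum>b\<in>B. b $ i * b $ i)" for i
  proof -
    have "E $ i $ i = (E *v axis i 1) $ i" by (simp add: matrix_vector_mult_basis column_def)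
    also have "\<dots> = (\<Sum>b\<in>B. b $ i * b $ i)"
      by (simp add: expand inner_axis)
    finally show ?thesis .
  qed
  then have "(\<Sum>i\<in>UNIV. E $ i $ i) = (\<Sum>b\<in>B. \<Sum>i\<in>UNIV. b $ i * b $ i)"
    using sum.swap by simp
  also have "\<dots> = (\<Sum>b\<in>B. b \<bullet> b)" by (simp add: inner_vec_def)
  also have "\<dots> = (\<Sum>b\<in>B. 1)" using B(3) by (intro sum.cong) (auto simp: norm_eq_1)
  finally show ?thesis using B(5) by simp
qed

text \<open>
  The product of the commuting operators \<open>A - t I\<close> over the list, applied to a vector: a polynomial in
  \<open>A\<close> whose degree is the length of the list.
\<close>

fun shift_product :: "real^'n^'n \<Rightarrow> real list \<Rightarrow> real^'n \<Rightarrow> real^'n" where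
  "shift_product A [] v = v"
| "shift_product A (t # ts) v = A *v shift_product A ts v - t *\<^sub>R shift_product A ts v"

lemma linear_shift_product: "linear (shift_product A ts)"
proof (induction ts)
  case Nil
  then show ?case by (simp add: linear_iff)
next
  case (Cons t ts)
  then show ?case
    by (simp add: linear_iff matrix_vector_right_distrib matrix_vector_mult_scaleR algebra_simps)
qed

lemma shift_product_eigenvector:
  assumes "A *v v = \<theta> *\<^sub>R v"
  shows "shift_product A ts v = prod_list (map (\<lambda>t. \<theta> - t) ts) *\<^sub>R v"
  by (induction ts) (simp_all add: assms matrix_vector_mult_scaleR algebra_simps)

lemma shift_product_all_eigenvalues:
  fixes A :: "real^'n^'n"
  assumes sym: "transpose A = A"
    and ts: "{\<theta>. \<exists>v. v \<noteq> 0 \<and> A *v v = \<theta> *\<^sub>R v} \<subseteq> set ts"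
  shows "shift_product A ts v = 0"
proof -
  have "shift_product A ts u = 0" if "u \<in> {v. \<exists>\<theta>. A *v v = \<theta> *\<^sub>R v}" for u
  proof (cases "u = 0")
    case False
    from that obtain \<theta> where \<theta>: "A *v u = \<theta> *\<^sub>R u" by auto
    then have "\<theta> \<in> set ts" using ts False by auto
    then have "prod_list (map (\<lambda>t. \<theta> - t) ts) = 0" by (auto simp: prod_list_zero_iff)
    then show ?thesis by (simp add: shift_product_eigenvector[OF \<theta>])
  qed (simp add: linear_0[OF linear_shift_product])
  moreover have "v \<in> span {v. \<exists>\<theta>. A *v v = \<theta> *\<^sub>R v}"
    using symmetric_matrix_eigenvectors_span[OF sym] by simp
  ultimately show ?thesis
    by (rule linear_eq_0_on_span[OF linear_shift_product])
qed

context drg begin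

section \<open>Eigenvalues and the three-term recurrence\<close>

text \<open>
  The recurrence of a cosine sequence. The terms with the indices -1 and \<open>d + 1\<close> carry the
  coefficients \<open>c\<^sub>0 = 0\<close> and \<open>b\<^sub>d = 0\<close>. The values lie in an arbitrary real field because complex
  sequences have to be shown to be real first.
\<close>

definition three_term :: "'a::real_field \<Rightarrow> (nat \<Rightarrow> 'a) \<Rightarrow> bool" where
  "three_term \<theta> u \<longleftrightarrow> (\<forall>i\<le>d. of_nat (c_num G i) * u (i - 1) + of_nat (a_num G i) * u i
      + of_nat (b_num G i) * u (Suc i) = \<theta> * u i)"

lemma three_termD:
  "three_term \<theta> u \<Longrightarrow> i \<le> d \<Longrightarrow> of_nat (c_num G i) * u (i - 1) + of_nat (a_num G i) * u i
      + of_nat (b_num G i) * u (Suc i) = \<theta> * u i"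
  unfolding three_term_def by blast

lemma adjacency_mult: "(adjacency_matrix G *v v) $ x = (\<Sum>y | D x y = 1. v $ y)"
proof -
  have "(adjacency_matrix G *v v) $ x = (\<Sum>y\<in>UNIV. if D x y = 1 then v $ y else 0)"
    unfolding matrix_vector_mult_def adjacency_matrix_def dist_1_iff
    by (simp add: if_distrib[where f = "\<lambda>t. t * _"] cong: if_cong)
  then show ?thesis by (simp add: sum.If_cases)
qed

lemma adjacency_symmetric: "transpose (adjacency_matrix G) = adjacency_matrix G"
  using dist_commute dist_1_iff
  by (simp add: transpose_def adjacency_matrix_def vec_eq_iff) metis

definition profile_matrix :: "(nat \<Rightarrow> real) \<Rightarrow> real^'v^'v" where
  "profile_matrix u = (\<chi> x y. u (D x y))"

lemma profile_matrix_sum: "(\<Sum>i\<le>d. u i *\<^sub>R distance_matrix G i) = profile_matrix u"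
proof -
  have "(\<Sum>i\<le>d. u i * (if D x y = i then 1 else 0)) = u (D x y)" for x y
    using dist_le_d[of x y] by (simp add: if_distrib cong: if_cong)
  then show ?thesis
    by (simp add: vec_eq_iff profile_matrix_def distance_matrix_def sum_component)
qed

lemma profile_matrix_symmetric: "transpose (profile_matrix u) = profile_matrix u"
  using dist_commute by (simp add: transpose_def profile_matrix_def vec_eq_iff)

lemma profile_matrix_mult: "(profile_matrix u *v v) $ x = (\<Sum>y\<in>UNIV. u (D x y) * v $ y)"
  by (simp add: matrix_vector_mult_def profile_matrix_def)

lemma adjacency_profile:
  fixes u :: "nat \<Rightarrow> 'a::real_field"
  assumes "three_term \<theta> u"
  shows "(\<Sum>z | D x z = 1. u (D z y)) = \<theta> * u (D x y)"
  using three_termD[OF assms dist_le_d[of x y]] by (simp only: sum_neighbours)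

text \<open>
  Every distance up to \<open>d\<close> occurs between two vertices, so the eigenvector equation for all columns of
  the profile matrix contains the whole recurrence.
\<close>

lemma three_termI:
  fixes u :: "nat \<Rightarrow> 'a::real_field"
  assumes "\<And>x y. (\<Sum>z | D x z = 1. u (D z y)) = \<theta> * u (D x y)"
  shows "three_term \<theta> u"
  unfolding three_term_def
proof (intro allI impI)
  fix i assume "i \<le> d"
  then obtain x y where "D x y = i" by (rule dist_attained)
  moreover have "(\<Sum>z | D x z = 1. u (D z y)) = \<theta> * u (D x y)" by (rule assms)
  ultimately show "of_nat (c_num G i) * u (i - 1) + of_nat (a_num G i) * u i
      + of_nat (b_num G i) * u (Suc i) = \<theta> * u i"
    unfolding sum_neighbours by metis
qed

text \<open>
  Each column of the profile matrix is an eigenvector, by the recurrence.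
\<close>

lemma profile_mult_in_eigenspace:
  assumes "three_term \<theta> u"
  shows "adjacency_matrix G *v (profile_matrix u *v v) = \<theta> *\<^sub>R (profile_matrix u *v v)"
proof -
  have "(\<Sum>z | D x z = 1. \<Sum>y\<in>UNIV. u (D z y) * v $ y) = \<theta> * (\<Sum>y\<in>UNIV. u (D x y) * v $ y)" for x
  proof -
    have "(\<Sum>z | D x z = 1. \<Sum>y\<in>UNIV. u (D z y) * v $ y)
        = (\<Sum>y\<in>UNIV. (\<Sum>z | D x z = 1. u (D z y)) * v $ y)"
      by (subst sum.swap) (simp add: sum_distrib_right)
    also have "\<dots> = (\<Sum>y\<in>UNIV. (\<theta> * u (D x y)) * v $ y)"
      by (simp only: adjacency_profile[OF assms])
    finally show ?thesis by (simp add: sum_distrib_left mult.assoc)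
  qed
  then show ?thesis by (simp add: vec_eq_iff adjacency_mult profile_matrix_mult)
qed

lemma subspace_eigenspace: "subspace (eigenspace G \<theta>)"
  by (auto simp: subspace_def eigenspace_def matrix_vector_right_distrib matrix_vector_mult_scaleR
      scaleR_add_right mult.commute)

text \<open>
  Summing over pairs of adjacent vertices \<open>y\<close>, \<open>z\<close> with \<open>y\<close> on the sphere of radius \<open>i\<close> around \<open>x\<close> from the
  side of \<open>z\<close> gives the transpose of the three-term recurrence.
\<close>

lemma sphere_sum_recurrence:
  assumes v: "adjacency_matrix G *v v = \<theta> *\<^sub>R v" and i: "i \<le> d"
  shows "(if i = 0 then 0 else b_num G (i - 1) * (\<Sum>y | D y x = i - 1. v $ y))
     + a_num G i * (\<Sum>y | D y x = i. v $ y)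
     + (if i = d then 0 else c_num G (Suc i) * (\<Sum>y | D y x = Suc i. v $ y))
     = \<theta> * (\<Sum>y | D y x = i. v $ y)"
proof -
  have "\<theta> * (\<Sum>y | D y x = i. v $ y) = (\<Sum>y | D y x = i. (adjacency_matrix G *v v) $ y)"
    by (simp add: v sum_distrib_left)
  also have "\<dots> = (\<Sum>y | D y x = i. \<Sum>z | D y z = 1. v $ z)"
    by (simp add: adjacency_mult)
  also have "\<dots> = (\<Sum>y\<in>UNIV. \<Sum>z\<in>UNIV. if D y x = i \<and> D y z = 1 then v $ z else 0)"
  proof -
    have "(\<Sum>z\<in>UNIV. if D y x = i \<and> D y z = 1 then v $ z else 0)
        = (if D y x = i then \<Sum>z | D y z = 1. v $ z else 0)" for y
      by (simp add: sum.If_cases)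
    then show ?thesis by (simp add: sum.If_cases)
  qed
  also have "\<dots> = (\<Sum>z\<in>UNIV. \<Sum>y\<in>UNIV. if D y x = i \<and> D y z = 1 then v $ z else 0)"
    by (rule sum.swap)
  also have "\<dots> = (\<Sum>z\<in>UNIV. v $ z * (\<Sum>y | D z y = 1. if D y x = i then 1 else 0))"
  proof (rule sum.cong[OF refl])
    fix z
    show "(\<Sum>y\<in>UNIV. if D y x = i \<and> D y z = 1 then v $ z else 0)
        = v $ z * (\<Sum>y | D z y = 1. if D y x = i then 1 else 0)"
      unfolding sum_distrib_left dist_commute[of _ z]
      by (rule sum.mono_neutral_cong_right) auto
  qed
  also have "\<dots> = (\<Sum>z\<in>UNIV. v $ z * (real (c_num G (D z x)) * (if D z x - 1 = i then 1 else 0)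
        + real (a_num G (D z x)) * (if D z x = i then 1 else 0)
        + real (b_num G (D z x)) * (if Suc (D z x) = i then 1 else 0)))"
    by (simp only: sum_neighbours[where f = "\<lambda>j. if j = i then 1 else (0::real)"] of_nat_id)
  also have "\<dots> = (\<Sum>z\<in>UNIV. (if D z x = Suc i then c_num G (Suc i) * v $ z else 0)
        + (if D z x = i then a_num G i * v $ z else 0)
        + (if Suc (D z x) = i then b_num G (i - 1) * v $ z else 0))"
  proof (rule sum.cong[OF refl])
    fix z
    show "v $ z * (real (c_num G (D z x)) * (if D z x - 1 = i then 1 else 0)
        + real (a_num G (D z x)) * (if D z x = i then 1 else 0)
        + real (b_num G (D z x)) * (if Suc (D z x) = i then 1 else 0))
      = (if D z x = Suc i then c_num G (Suc i) * v $ z else 0)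
        + (if D z x = i then a_num G i * v $ z else 0)
        + (if Suc (D z x) = i then b_num G (i - 1) * v $ z else 0)"
      by (cases "D z x") (auto simp del: dist_0_iff)
  qed
  also have "\<dots> = c_num G (Suc i) * (\<Sum>y | D y x = Suc i. v $ y)
     + a_num G i * (\<Sum>y | D y x = i. v $ y)
     + b_num G (i - 1) * (\<Sum>y | Suc (D y x) = i. v $ y)"
    by (simp add: sum.distrib sum.If_cases sum_distrib_left)
  also have "(\<Sum>y | Suc (D y x) = i. v $ y) = (if i = 0 then 0 else (\<Sum>y | D y x = i - 1. v $ y))"
    by (cases i) auto
  also have "c_num G (Suc i) * (\<Sum>y | D y x = Suc i. v $ y) =
     (if i = d then 0 else c_num G (Suc i) * (\<Sum>y | D y x = Suc i. v $ y))"
  proof (cases "i = d")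
    case True
    have "D y x \<noteq> Suc d" for y using dist_le_d[of y x] by simp
    then show ?thesis using True by simp
  qed simp
  finally show ?thesis by simp
qed

text \<open>
  The size of a sphere of radius \<open>i\<close>, in terms of the intersection numbers.
\<close>

definition sphere_weight :: "nat \<Rightarrow> real" where
  "sphere_weight i = (\<Prod>j<i. b_num G j / c_num G (Suc j))"

lemma sphere_weight_pos: "i \<le> d \<Longrightarrow> 0 < sphere_weight i"
  unfolding sphere_weight_def using b_pos c_pos by (intro prod_pos) auto

lemma sphere_weight_Suc: "i < d \<Longrightarrow> c_num G (Suc i) * sphere_weight (Suc i) = b_num G i * sphere_weight i"
  using c_pos[of "Suc i"] by (simp add: sphere_weight_def)

text \<open>
  Up to the sphere sizes, the sums of an eigenvector over the spheres around \<open>x\<close> satisfy the same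
  recurrence as the cosine sequence and hence are proportional to it. The recurrence below \<open>d\<close>
  suffices, so the lemma also applies to sequences that are not yet known to close up at \<open>d\<close>.
\<close>

lemma sphere_sum_eigenvector:
  fixes u :: "nat \<Rightarrow> real"
  assumes v: "adjacency_matrix G *v v = \<theta> *\<^sub>R v"
    and u0: "u 0 = 1"
    and u: "\<And>i. i < d \<Longrightarrow> c_num G i * u (i - 1) + a_num G i * u i + b_num G i * u (Suc i) = \<theta> * u i"
    and i: "i \<le> d"
  shows "(\<Sum>y | D y x = i. v $ y) = sphere_weight i * u i * v $ x"
  using i
proof (induction i rule: less_induct)
  case (less i)
  show ?case
  proof (cases i)
    case 0
    then show ?thesis by (simp add: sphere_weight_def u0)
  next
    case (Suc j)
    then have j: "j < d" using less.prems by simp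
    let ?S = "\<lambda>i. \<Sum>y | D y x = i. v $ y"
    have rec: "(if j = 0 then 0 else b_num G (j - 1) * ?S (j - 1)) + a_num G j * ?S j
        + c_num G (Suc j) * ?S (Suc j) = \<theta> * ?S j"
      using sphere_sum_recurrence[OF v, of j x] j by simp
    have Sj: "?S j = sphere_weight j * u j * v $ x" using less.IH[of j] Suc j by simp
    have "(if j = 0 then 0 else b_num G (j - 1) * ?S (j - 1)) = c_num G j * sphere_weight j * u (j - 1) * v $ x"
    proof (cases j)
      case (Suc l)
      then have "?S l = sphere_weight l * u l * v $ x" using less.IH[of l] \<open>i = Suc j\<close> j by simp
      then show ?thesis using sphere_weight_Suc[of l] Suc j by simp
    qed simp
    with rec Sj have "c_num G (Suc j) * ?S (Suc j) =
        sphere_weight j * v $ x * (\<theta> * u j - a_num G j * u j - c_num G j * u (j - 1))"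
      by (simp add: algebra_simps)
    also have "\<theta> * u j - a_num G j * u j - c_num G j * u (j - 1) = b_num G j * u (Suc j)"
      using u[OF j] by simp
    also have "sphere_weight j * v $ x * (b_num G j * u (Suc j))
        = c_num G (Suc j) * (sphere_weight (Suc j) * u (Suc j) * v $ x)"
      using sphere_weight_Suc[OF j] by (simp add: algebra_simps)
    finally show ?thesis using c_pos[of "Suc j"] j Suc by simp
  qed
qed

text \<open>
  The eigenvalue of the profile matrix on the eigenspace of \<open>\<theta>\<close>; it is the number of vertices divided by the
  multiplicity of \<open>\<theta>\<close>.
\<close>

definition profile_norm :: "(nat \<Rightarrow> real) \<Rightarrow> real" where
  "profile_norm u = (\<Sum>i\<le>d. sphere_weight i * (u i)\<^sup>2)"

lemma profile_norm_pos:
  fixes u :: "nat \<Rightarrow> real"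
  shows "u 0 = 1 \<Longrightarrow> 0 < profile_norm u"
  unfolding profile_norm_def
proof (rule sum_pos2[of _ 0])
  show "0 \<le> sphere_weight i * (u i)\<^sup>2" if "i \<in> {..d}" for i
    using sphere_weight_pos[of i] that by simp
qed (simp_all add: sphere_weight_def)

lemma profile_mult_eigenvector:
  assumes u: "three_term \<theta> u" "u 0 = 1" and v: "adjacency_matrix G *v v = \<theta> *\<^sub>R v"
  shows "profile_matrix u *v v = profile_norm u *\<^sub>R v"
proof -
  have "(profile_matrix u *v v) $ x = profile_norm u * v $ x" for x
  proof -
    have "(profile_matrix u *v v) $ x = (\<Sum>y\<in>UNIV. u (D y x) * v $ y)"
      by (simp add: profile_matrix_mult dist_commute[of x])
    also have "\<dots> = (\<Sum>i\<le>d. \<Sum>y | D y x = i. u (D y x) * v $ y)"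
      using sum.group[of UNIV "{..d}" "\<lambda>y. D y x" "\<lambda>y. u (D y x) * v $ y"] dist_le_d
      by (simp add: image_subset_iff)
    also have "\<dots> = (\<Sum>i\<le>d. u i * (\<Sum>y | D y x = i. v $ y))"
      by (simp add: sum_distrib_left)
    also have "\<dots> = (\<Sum>i\<le>d. sphere_weight i * (u i)\<^sup>2 * v $ x)"
    proof (rule sum.cong[OF refl])
      fix i assume "i \<in> {..d}"
      then have "(\<Sum>y | D y x = i. v $ y) = sphere_weight i * u i * v $ x"
        using three_termD[OF u(1)] by (intro sphere_sum_eigenvector[where u = u, OF v u(2)]) auto
      then show "u i * (\<Sum>y | D y x = i. v $ y) = sphere_weight i * (u i)\<^sup>2 * v $ x"
        by (simp add: power2_eq_square)
    qed
    finally show ?thesis by (simp add: profile_norm_def sum_distrib_right)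
  qed
  then show ?thesis by (simp add: vec_eq_iff)
qed

text \<open>
  The profile matrix \<open>F\<close> maps into the eigenspace and acts there as the scalar \<open>N = profile_norm u\<close>.
  Hence \<open>F\<^sup>2 = N F\<close>, so it is \<open>N\<close> times a projection and positive semidefinite.
\<close>

lemma profile_quadratic_form:
  assumes u: "three_term \<theta> u" "u 0 = 1"
  shows "profile_norm u * (v \<bullet> (profile_matrix u *v v)) = (profile_matrix u *v v) \<bullet> (profile_matrix u *v v)"
  using profile_mult_eigenvector[OF u profile_mult_in_eigenspace[OF u(1)], of v]
  by (simp add: symmetric_matrix_inner[OF profile_matrix_symmetric])

lemma profile_psd:
  assumes u: "three_term \<theta> u" "u 0 = 1"
  shows "0 \<le> v \<bullet> (profile_matrix u *v v)"
  using profile_quadratic_form[OF u, of v] profile_norm_pos[of u] u(2)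
  by (metis inner_ge_zero zero_le_mult_iff not_less)

lemma profile_psd_eq_0:
  assumes u: "three_term \<theta> u" "u 0 = 1" and "v \<bullet> (profile_matrix u *v v) = 0"
  shows "profile_matrix u *v v = 0"
  using profile_quadratic_form[OF u, of v] assms(3) by simp

lemma profile_matrix_axis: "profile_matrix u *v axis y 1 = (\<chi> x. u (D x y))"
  by (simp add: vec_eq_iff matrix_vector_mult_basis column_def profile_matrix_def)

lemma three_term_eigenvalue:
  assumes u: "three_term \<theta> u" "u 0 = 1"
  shows "\<theta> \<in> eigenvalues G"
proof -
  let ?v = "profile_matrix u *v axis undefined 1"
  have "?v $ undefined = 1" by (simp add: profile_matrix_axis u(2))
  then have "?v \<noteq> 0" by (metis zero_index zero_neq_one)
  then show ?thesis using profile_mult_in_eigenspace[OF u(1)] unfolding eigenvalues_def by blast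
qed

text \<open>
  The profile matrix divided by its norm is the projection onto the eigenspace, and comparing traces
  identifies the scalar with the one in the definition of a cosine sequence.
\<close>

lemma three_term_cosine_sequence:
  assumes u: "three_term \<theta> u" "u 0 = 1"
  shows "cosine_sequence G \<theta> u"
proof -
  let ?N = "profile_norm u"
  define E where "E = (1 / ?N) *\<^sub>R profile_matrix u"
  have N: "0 < ?N" using profile_norm_pos[of u] u(2) by simp
  have E_mult: "E *v v = (1 / ?N) *\<^sub>R (profile_matrix u *v v)" for v
    by (simp add: E_def scaleR_matrix_vector_assoc)
  have E: "orthogonal_projection_matrix E (eigenspace G \<theta>)"
    unfolding orthogonal_projection_matrix_def
  proof (intro allI conjI ballI)
    fix v
    have "profile_matrix u *v v \<in> eigenspace G \<theta>"
      using profile_mult_in_eigenspace[OF u(1)] by (simp add: eigenspace_def)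
    then show "E *v v \<in> eigenspace G \<theta>"
      unfolding E_mult by (rule subspace_scale[OF subspace_eigenspace])
    fix w assume "w \<in> eigenspace G \<theta>"
    then have "profile_matrix u *v w = ?N *\<^sub>R w"
      using profile_mult_eigenvector[OF u] by (simp add: eigenspace_def)
    then show "orthogonal (v - E *v v) w"
      using N by (simp add: E_mult orthogonal_def inner_diff_left
          symmetric_matrix_inner[OF profile_matrix_symmetric])
  qed
  have "(\<Sum>i\<in>UNIV. E $ i $ i) = real (multiplicity_of G \<theta>)"
    unfolding multiplicity_of_def by (simp add: trace_orthogonal_projection[OF E subspace_eigenspace])
  moreover have "(\<Sum>i\<in>UNIV. E $ i $ i) = real (card (verts G)) / ?N"
    by (simp add: E_def profile_matrix_def u(2) verts_UNIV)
  ultimately have "real (multiplicity_of G \<theta>) / real (card (verts G)) = 1 / ?N"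
    by (simp add: verts_UNIV field_simps)
  then have "E = (real (multiplicity_of G \<theta>) / real (card (verts G))) *\<^sub>R
      (\<Sum>i\<le>d. u i *\<^sub>R distance_matrix G i)"
    by (simp add: E_def profile_matrix_sum)
  then show ?thesis
    unfolding cosine_sequence_def using E three_term_eigenvalue[OF u] by blast
qed

text \<open>
  The image of the projection lies in the eigenspace, which yields the recurrence column by column;
  the trace yields the normalisation at 0.
\<close>

lemma cosine_sequence_three_term:
  assumes "cosine_sequence G \<theta> s"
  shows "three_term \<theta> s" "s 0 = 1"
proof -
  let ?m = "real (multiplicity_of G \<theta>)" and ?n = "real (card (verts G))"
  obtain E where E: "orthogonal_projection_matrix E (eigenspace G \<theta>)"
    and E_eq: "E = (?m / ?n) *\<^sub>R profile_matrix s" and \<theta>: "\<theta> \<in> eigenvalues G"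
    using assms unfolding cosine_sequence_def profile_matrix_sum by blast
  have n: "?n > 0" by (simp add: verts_UNIV)
  have "multiplicity_of G \<theta> \<noteq> 0"
    using \<theta> unfolding multiplicity_of_def dim_eq_0 eigenvalues_def eigenspace_def by blast
  then have m: "?m > 0" by simp
  have "?m = (\<Sum>i\<in>UNIV. E $ i $ i)"
    unfolding multiplicity_of_def by (simp add: trace_orthogonal_projection[OF E subspace_eigenspace])
  also have "\<dots> = ?m * s 0"
    using n by (simp add: E_eq profile_matrix_def verts_UNIV)
  finally show "s 0 = 1" using m by simp
  show "three_term \<theta> s"
  proof (rule three_termI)
    fix x y
    let ?w = "profile_matrix s *v axis y 1"
    have "E *v axis y 1 \<in> eigenspace G \<theta>"
      using E by (simp add: orthogonal_projection_matrix_def)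
    then have "(?m / ?n) *\<^sub>R (adjacency_matrix G *v ?w) = (?m / ?n) *\<^sub>R (\<theta> *\<^sub>R ?w)"
      by (simp add: E_eq eigenspace_def scaleR_matrix_vector_assoc[symmetric] matrix_vector_mult_scaleR)
    then have "adjacency_matrix G *v ?w = \<theta> *\<^sub>R ?w"
      unfolding scaleR_cancel_left using divide_pos_pos[OF m n] by linarith
    then have "(adjacency_matrix G *v ?w) $ x = (\<theta> *\<^sub>R ?w) $ x" by simp
    then show "(\<Sum>z | D x z = 1. s (D z y)) = \<theta> * s (D x y)"
      unfolding adjacency_mult profile_matrix_axis by simp
  qed
qed


section \<open>The spectrum\<close>

text \<open>
  The cosine sequence of \<open>\<theta>\<close> as a polynomial in \<open>\<theta>\<close>, from the recurrence solved for its last term.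
  The values at indices above \<open>d\<close> are meaningless, since \<open>b\<^sub>d = 0\<close>.
\<close>

fun cosine_poly :: "nat \<Rightarrow> real poly" where
  "cosine_poly 0 = 1"
| "cosine_poly (Suc i) = smult (1 / b_num G i)
     ([:- real (a_num G i), 1:] * cosine_poly i - smult (c_num G i) (cosine_poly (i - 1)))"

declare cosine_poly.simps(2) [simp del]

lemma degree_three_term_step:
  fixes p q :: "real poly"
  assumes "degree p = n" "degree q \<le> n" "p \<noteq> 0"
  shows "degree ([:- s, 1:] * p - smult t q) = Suc n"
proof -
  have "degree ([:- s, 1:] * p) = Suc n"
    using assms by (subst degree_mult_eq) auto
  moreover have "degree (- smult t q) < Suc n"
    using assms(2) degree_smult_le[of t q] by simp
  ultimately show ?thesis
    using degree_add_eq_left[of "- smult t q" "[:- s, 1:] * p"] by simp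
qed

lemma degree_cosine_poly: "i \<le> d \<Longrightarrow> degree (cosine_poly i) = i"
proof (induction i rule: less_induct)
  case (less i)
  show ?case
  proof (cases i)
    case (Suc j)
    have "degree (cosine_poly j) = j" "degree (cosine_poly (j - 1)) \<le> j"
      using less.IH[of j] less.IH[of "j - 1"] less.prems Suc by auto
    moreover have "cosine_poly j \<noteq> 0"
      using \<open>degree (cosine_poly j) = j\<close> by (cases j) auto
    ultimately have "degree ([:- real (a_num G j), 1:] * cosine_poly j
        - smult (c_num G j) (cosine_poly (j - 1))) = Suc j"
      by (intro degree_three_term_step)
    then show ?thesis using b_pos[of j] less.prems unfolding Suc cosine_poly.simps(2) degree_smult_eq by simp
  qed simp
qed

lemma cosine_poly_recurrence:
  assumes "i < d"
  shows "c_num G i * poly (cosine_poly (i - 1)) \<theta> + a_num G i * poly (cosine_poly i) \<theta>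
    + b_num G i * poly (cosine_poly (Suc i)) \<theta> = \<theta> * poly (cosine_poly i) \<theta>"
  using b_pos[OF assms] by (simp add: cosine_poly.simps(2) algebra_simps)

text \<open>
  Below \<open>d\<close> the recurrence holds by construction. The last equation is where \<open>\<theta>\<close> has to be an
  eigenvalue: it is the recurrence of the sphere sums of an eigenvector around a vertex where it does
  not vanish.
\<close>

lemma eigenvalue_three_term:
  assumes "\<theta> \<in> eigenvalues G"
  shows "three_term \<theta> (\<lambda>i. poly (cosine_poly i) \<theta>)"
proof -
  let ?u = "\<lambda>i. poly (cosine_poly i) \<theta>"
  obtain v where v: "v \<noteq> 0" "adjacency_matrix G *v v = \<theta> *\<^sub>R v"
    using assms unfolding eigenvalues_def by blast
  obtain x where x: "v $ x \<noteq> 0" using v(1) by (auto simp: vec_eq_iff)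
  have S: "(\<Sum>y | D y x = i. v $ y) = sphere_weight i * ?u i * v $ x" if "i \<le> d" for i
    by (rule sphere_sum_eigenvector[where u = ?u, OF v(2) _ _ that])
      (simp, rule cosine_poly_recurrence)
  obtain e where e: "d = Suc e" using diam_ge_2 by (cases d) auto
  have "b_num G e * (sphere_weight e * ?u e * v $ x) + a_num G d * (sphere_weight d * ?u d * v $ x)
      = \<theta> * (sphere_weight d * ?u d * v $ x)"
    using sphere_sum_recurrence[OF v(2), of d x] S[of d] S[of e] e by simp
  moreover have "real (b_num G e) * (sphere_weight e * ?u e * v $ x)
      = real (c_num G d) * sphere_weight d * ?u e * v $ x"
    using sphere_weight_Suc[of e] e by simp
  ultimately have "sphere_weight d * v $ x * (c_num G d * ?u e + a_num G d * ?u d)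
      = sphere_weight d * v $ x * (\<theta> * ?u d)"
    by (simp only: algebra_simps)
  then have last: "c_num G d * ?u e + a_num G d * ?u d = \<theta> * ?u d"
    using x sphere_weight_pos[of d] by simp
  show ?thesis
    unfolding three_term_def
  proof (intro allI impI)
    fix i assume "i \<le> d"
    show "of_nat (c_num G i) * ?u (i - 1) + of_nat (a_num G i) * ?u i
      + of_nat (b_num G i) * ?u (Suc i) = \<theta> * ?u i"
    proof (cases "i < d")
      case False
      then have i: "i = d" using \<open>i \<le> d\<close> by simp
      show ?thesis unfolding i b_d using last e by simp
    qed (rule cosine_poly_recurrence)
  qed
qed

text \<open>
  The last equation of the recurrence is a polynomial equation of degree \<open>d + 1\<close> for \<open>\<theta>\<close>.
\<close>

lemma eigenvalues_card_le: "finite (eigenvalues G)" "card (eigenvalues G) \<le> Suc d"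
proof -
  define p where "p = [:- real (a_num G d), 1:] * cosine_poly d - smult (c_num G d) (cosine_poly (d - 1))"
  have "cosine_poly d \<noteq> 0" using degree_cosine_poly[of d] diam_ge_2 by auto
  then have deg: "degree p = Suc d"
    unfolding p_def by (intro degree_three_term_step) (simp_all add: degree_cosine_poly)
  then have "p \<noteq> 0" by auto
  have sub: "eigenvalues G \<subseteq> {x. poly p x = 0}"
  proof
    fix \<theta> assume "\<theta> \<in> eigenvalues G"
    from three_termD[OF eigenvalue_three_term[OF this], of d]
    show "\<theta> \<in> {x. poly p x = 0}" by (simp add: p_def algebra_simps)
  qed
  have fin: "finite {x. poly p x = 0}" by (rule poly_roots_finite[OF \<open>p \<noteq> 0\<close>])
  show "finite (eigenvalues G)" by (rule finite_subset[OF sub fin])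
  show "card (eigenvalues G) \<le> Suc d"
    using card_mono[OF fin sub] card_poly_roots_bound[OF \<open>p \<noteq> 0\<close>] deg by simp
qed

text \<open>
  A polynomial of degree \<open>n\<close> in the adjacency matrix does not see beyond distance \<open>n\<close>, and at distance
  exactly \<open>n\<close> only its leading term contributes, through the number of walks of length \<open>n\<close>.
\<close>

lemma shift_product_axis:
  "(length ts < D y x \<longrightarrow> shift_product (adjacency_matrix G) ts (axis x 1) $ y = 0) \<and>
   (length ts = D y x \<longrightarrow> 0 < shift_product (adjacency_matrix G) ts (axis x 1) $ y)"
proof (induction ts arbitrary: y)
  case Nil
  show ?case by (auto simp: axis_def)
next
  case (Cons t ts)
  let ?w = "shift_product (adjacency_matrix G) ts (axis x 1)"
  have step: "shift_product (adjacency_matrix G) (t # ts) (axis x 1) $ y =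
      (\<Sum>z | D y z = 1. ?w $ z) - t * ?w $ y"
    by (simp add: adjacency_mult)
  have far: "?w $ z = 0" if "length ts < D z x" for z using Cons.IH[of z] that by blast
  have near: "0 < ?w $ z" if "length ts = D z x" for z using Cons.IH[of z] that by blast
  show ?case
  proof (intro conjI impI)
    assume *: "length (t # ts) < D y x"
    have "?w $ z = 0" if "D y z = 1" for z
      using dist_triangle[of y x z] that * by (intro far) simp
    then show "shift_product (adjacency_matrix G) (t # ts) (axis x 1) $ y = 0"
      unfolding step using far[of y] * by simp
  next
    assume *: "length (t # ts) = D y x"
    obtain z where z: "D y z = 1" "D z x = length ts"
      using step_towards[of y x "length ts"] * by auto
    have "0 \<le> ?w $ z" if "D y z = 1" for z
    proof -
      have "length ts \<le> D z x" using dist_triangle[of y x z] that * by simp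
      then show ?thesis using far[of z] near[of z] by (cases "length ts = D z x") auto
    qed
    then have "0 < (\<Sum>z | D y z = 1. ?w $ z)"
      using z near[of z] by (intro sum_pos2[of _ z]) auto
    then show "0 < shift_product (adjacency_matrix G) (t # ts) (axis x 1) $ y"
      unfolding step using far[of y] * by simp
  qed
qed

text \<open>
  Fewer eigenvalues would give an annihilating polynomial of degree at most \<open>d\<close>, contradicting the
  positive entries that it has at the distance equal to its degree.
\<close>

lemma card_eigenvalues: "card (eigenvalues G) = Suc d"
proof (rule ccontr)
  let ?ts = "sorted_list_of_set (eigenvalues G)"
  assume "card (eigenvalues G) \<noteq> Suc d"
  then have "length ?ts \<le> d" using eigenvalues_card_le by simp
  then obtain y x where "D y x = length ?ts" by (rule dist_attained)
  then have "0 < shift_product (adjacency_matrix G) ?ts (axis x 1) $ y"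
    using shift_product_axis[of ?ts y x] by simp
  moreover have "shift_product (adjacency_matrix G) ?ts (axis x 1) = 0"
    by (rule shift_product_all_eigenvalues[OF adjacency_symmetric])
      (simp add: eigenvalues_card_le(1) eigenvalues_def[symmetric])
  ultimately show False by simp
qed

lemma nth_eigenvalue_eq:
  "i \<le> d \<Longrightarrow> nth_eigenvalue G i = sorted_list_of_set (eigenvalues G) ! (d - i)"
  unfolding nth_eigenvalue_def
  by (subst rev_nth) (simp_all add: card_eigenvalues)

lemma nth_eigenvalue_in: "i \<le> d \<Longrightarrow> nth_eigenvalue G i \<in> eigenvalues G"
  unfolding nth_eigenvalue_eq
  using nth_mem[of "d - i" "sorted_list_of_set (eigenvalues G)"]
  by (simp add: card_eigenvalues eigenvalues_card_le(1))

lemma nth_eigenvalue_less: "i < j \<Longrightarrow> j \<le> d \<Longrightarrow> nth_eigenvalue G j < nth_eigenvalue G i"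
  using sorted_wrt_nth_less[OF strict_sorted_list_of_set[of "eigenvalues G"], of "d - j" "d - i"]
  by (simp add: nth_eigenvalue_eq card_eigenvalues)

lemma eigenvalue_nth:
  assumes "\<theta> \<in> eigenvalues G"
  obtains i where "i \<le> d" "\<theta> = nth_eigenvalue G i"
proof -
  have "\<theta> \<in> set (sorted_list_of_set (eigenvalues G))"
    using assms by (simp add: eigenvalues_card_le(1))
  then obtain j where j: "j < Suc d" "\<theta> = sorted_list_of_set (eigenvalues G) ! j"
    by (auto simp: in_set_conv_nth card_eigenvalues)
  then have "\<theta> = nth_eigenvalue G (d - j)" by (simp add: nth_eigenvalue_eq)
  then show ?thesis using that[of "d - j"] by simp
qed

lemma nth_eigenvalue_mono: "i \<le> j \<Longrightarrow> j \<le> d \<Longrightarrow> nth_eigenvalue G j \<le> nth_eigenvalue G i"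
  using nth_eigenvalue_less[of i j] by (cases "i = j") auto

lemma eigenvalue_ge_last: "\<theta> \<in> eigenvalues G \<Longrightarrow> nth_eigenvalue G d \<le> \<theta>"
  by (metis eigenvalue_nth nth_eigenvalue_mono order_refl)

lemma max_abs_entry:
  fixes v :: "real^'v"
  assumes "v \<noteq> 0"
  obtains x where "\<And>y. \<bar>v $ y\<bar> \<le> \<bar>v $ x\<bar>" "v $ x \<noteq> 0"
proof -
  have "Max (range (\<lambda>y. \<bar>v $ y\<bar>)) \<in> range (\<lambda>y. \<bar>v $ y\<bar>)" by (intro Max_in) auto
  then obtain x where x: "Max (range (\<lambda>y. \<bar>v $ y\<bar>)) = \<bar>v $ x\<bar>" by (metis imageE)
  have le: "\<bar>v $ y\<bar> \<le> \<bar>v $ x\<bar>" for y unfolding x[symmetric] by (intro Max_ge) auto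
  moreover have "v $ x \<noteq> 0"
  proof
    assume "v $ x = 0"
    then have "v $ y = 0" for y using le[of y] by simp
    then show False using assms by (simp add: vec_eq_iff)
  qed
  ultimately show ?thesis by (rule that)
qed

lemma eigenvalue_abs_le:
  assumes "\<theta> \<in> eigenvalues G"
  shows "\<bar>\<theta>\<bar> \<le> valency G"
proof -
  obtain v where v: "v \<noteq> 0" "adjacency_matrix G *v v = \<theta> *\<^sub>R v"
    using assms unfolding eigenvalues_def by blast
  obtain x where x: "\<And>y. \<bar>v $ y\<bar> \<le> \<bar>v $ x\<bar>" "v $ x \<noteq> 0"
    by (rule max_abs_entry[OF v(1)]) (rule that)
  have "\<bar>\<theta>\<bar> * \<bar>v $ x\<bar> = \<bar>\<Sum>z | D x z = 1. v $ z\<bar>"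
    using arg_cong[OF v(2), of "\<lambda>w. w $ x"] by (simp add: adjacency_mult abs_mult)
  also have "\<dots> \<le> (\<Sum>z | D x z = 1. \<bar>v $ x\<bar>)"
    by (rule order_trans[OF sum_abs sum_mono]) (rule x(1))
  also have "\<dots> = valency G * \<bar>v $ x\<bar>" by (simp add: card_neighbours del: One_nat_def)
  finally show ?thesis using x(2) by simp
qed

text \<open>
  For \<open>\<theta> = \<plusminus>k\<close> the triangle inequality at a vertex of maximal absolute value is an equality, so the
  neighbours carry the same value up to the sign \<open>e\<close>, and this propagates along walks.
\<close>

lemma extreme_eigenvector:
  fixes e :: real
  assumes v: "adjacency_matrix G *v v = (e * valency G) *\<^sub>R v" and e: "e * e = 1"
    and x: "\<And>y. \<bar>v $ y\<bar> \<le> \<bar>v $ x\<bar>" and nz: "v $ x \<noteq> 0"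
  shows "v $ y = e ^ D y x * v $ x"
proof (induction "D y x" arbitrary: y)
  case 0
  then show ?case by simp
next
  case (Suc n)
  then obtain z where z: "D y z = 1" "D z x = n" using step_towards by metis
  define m where "m = v $ z"
  have m: "m = e ^ n * v $ x" using Suc.hyps(1)[of z] z(2) by (simp add: m_def)
  have "e = 1 \<or> e = - 1" using e by (simp add: square_eq_1_iff)
  then have "\<bar>e\<bar> = 1" by auto
  then have am: "\<bar>m\<bar> = \<bar>v $ x\<bar>" by (simp add: m abs_mult power_abs)
  \<comment> \<open>The entries of \<open>e m v\<close> at the neighbours of \<open>z\<close> average to \<open>m\<^sup>2\<close>, which none of them exceeds.\<close>
  have nonneg: "0 \<le> m * m - e * m * v $ u" for u
  proof -
    have "e * m * v $ u \<le> \<bar>m\<bar> * \<bar>v $ u\<bar>"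
      using \<open>\<bar>e\<bar> = 1\<close> abs_ge_self[of "e * m * v $ u"] by (simp add: abs_mult)
    also have "\<dots> \<le> \<bar>m\<bar> * \<bar>m\<bar>" unfolding am by (intro mult_left_mono x) simp
    finally show ?thesis by simp
  qed
  have "(\<Sum>u | D z u = 1. v $ u) = e * valency G * m"
    using arg_cong[OF v, of "\<lambda>w. w $ z"] by (simp add: adjacency_mult m_def)
  then have "(\<Sum>u | D z u = 1. m * m - e * m * v $ u) = valency G * (m * m) - e * m * (e * valency G * m)"
    by (simp add: sum_subtractf card_neighbours sum_distrib_left[symmetric] del: One_nat_def)
  also have "\<dots> = valency G * (m * m) - (e * e) * (valency G * (m * m))" by (simp add: algebra_simps)
  also have "\<dots> = 0" by (simp add: e)
  finally have "\<forall>u\<in>{u. D z u = 1}. m * m - e * m * v $ u = 0"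
    by (subst (asm) sum_nonneg_eq_0_iff) (simp, rule nonneg)
  moreover have "y \<in> {u. D z u = 1}" using z(1) dist_commute[of z y] by simp
  ultimately have "m * m - e * m * v $ y = 0" by (rule bspec)
  then have "m * (m - e * v $ y) = 0" by (simp add: algebra_simps)
  moreover have "m \<noteq> 0" using am nz by auto
  ultimately have "e * m = e * e * v $ y" by simp
  then have "v $ y = e ^ Suc n * v $ x" by (simp add: e m)
  then show ?case by (simp only: Suc.hyps(2))
qed

text \<open>
  An eigenvector of \<open>- k\<close> changes sign along every edge. Adjacent vertices at equal distance from a
  third one would therefore carry opposite and equal values.
\<close>

lemma eigenvalue_neg_valency_bipartite:
  assumes "- real (valency G) \<in> eigenvalues G"
  shows "drg_bipartite G"
  unfolding drg_bipartite_def
proof (intro allI impI)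
  fix i assume "i \<le> d"
  then obtain y x where yx: "D y x = i" by (rule dist_attained)
  obtain v where v: "v \<noteq> 0" "adjacency_matrix G *v v = (- 1 * real (valency G)) *\<^sub>R v"
    using assms unfolding eigenvalues_def by auto
  obtain x' where x': "\<And>y. \<bar>v $ y\<bar> \<le> \<bar>v $ x'\<bar>" and nz': "v $ x' \<noteq> 0"
    by (rule max_abs_entry[OF v(1)]) (rule that)
  have all: "\<bar>v $ y\<bar> = \<bar>v $ x'\<bar>" for y
    using extreme_eigenvector[OF v(2) _ x' nz', of y] by (simp add: abs_mult power_abs)
  have alt: "v $ w = (- 1) ^ D w z * v $ z" for w z
  proof (rule extreme_eigenvector[OF v(2)])
    show "\<bar>v $ y\<bar> \<le> \<bar>v $ z\<bar>" for y using all[of y] all[of z] by linarith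
    show "v $ z \<noteq> 0" using all[of z] nz' by linarith
  qed simp
  have "{z. D y z = 1 \<and> D z x = D y x} = {}"
  proof (rule ccontr)
    assume "{z. D y z = 1 \<and> D z x = D y x} \<noteq> {}"
    then obtain z where z: "D y z = 1" "D z x = D y x" by blast
    have "v $ y = - v $ z" using alt[of y z] z(1) by simp
    moreover have "v $ y = v $ z" using alt[of y x] alt[of z x] z(2) by simp
    ultimately have "v $ z = 0" by simp
    then show False using all[of z] nz' by simp
  qed
  then show "a_num G i = 0" using card_a[of y x] unfolding yx by (metis card.empty)
qed

lemma three_term_valency: "three_term (real (valency G)) (\<lambda>_. 1)"
  unfolding three_term_def using cab_sum by (auto simp flip: of_nat_add)

lemma valency_eigenvalue: "real (valency G) \<in> eigenvalues G"
  by (rule three_term_eigenvalue[OF three_term_valency]) simp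

lemma nth_eigenvalue_0: "nth_eigenvalue G 0 = valency G"
proof (rule antisym)
  show "nth_eigenvalue G 0 \<le> valency G"
    using eigenvalue_abs_le[OF nth_eigenvalue_in[of 0]] by simp
  show "valency G \<le> nth_eigenvalue G 0"
    using eigenvalue_nth[OF valency_eigenvalue] nth_eigenvalue_mono[of 0] by (metis le0)
qed

lemma eigenvalue_le_second:
  assumes "\<theta> \<in> eigenvalues G" "\<theta> \<noteq> valency G"
  shows "\<theta> \<le> nth_eigenvalue G 1"
proof -
  obtain i where i: "i \<le> d" "\<theta> = nth_eigenvalue G i" using eigenvalue_nth[OF assms(1)] .
  then have "i \<noteq> 0" using assms(2) nth_eigenvalue_0 by metis
  then show ?thesis using nth_eigenvalue_mono[of 1 i] i by simp
qed

lemma nth_eigenvalue_ends: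
  "nth_eigenvalue G d < nth_eigenvalue G 1" "nth_eigenvalue G 1 < valency G"
  using nth_eigenvalue_less[of 1 d] nth_eigenvalue_less[of 0 1] nth_eigenvalue_0 diam_ge_2 by auto

lemma adjacency_axis_inner:
  "axis x 1 \<bullet> (adjacency_matrix G *v axis y 1) = (if D x y = 1 then 1 else 0)"
  by (simp add: inner_axis' matrix_vector_mult_basis column_def adjacency_matrix_def dist_1_iff del: One_nat_def)

lemma axis_inner_axis_real: "axis x 1 \<bullet> (axis y 1 :: real^'v) = (if x = y then 1 else 0)"
  by (simp add: inner_axis_axis)

text \<open>
  On the complement of the constant vectors all eigenvalues differ from \<open>k\<close>. The difference of two
  vertices at distance 2 lies there and has Rayleigh quotient 0.
\<close>

lemma second_eigenvalue_nonneg: "0 \<le> nth_eigenvalue G 1"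
proof -
  let ?A = "adjacency_matrix G"
  let ?one = "(\<chi> i. 1) :: real^'v"
  let ?S = "{v. ?one \<bullet> v = 0}"
  obtain x y where xy: "D x y = 2" using dist_attained[OF diam_ge_2] .
  then have ne: "x \<noteq> y" by auto
  let ?w = "axis x 1 - axis y 1 :: real^'v"
  have S: "subspace ?S" by (simp add: subspace_def inner_add_right)
  have wS: "?w \<in> ?S" by (simp add: inner_diff_right inner_axis)
  have ww: "?w \<bullet> ?w = 2" using ne by (simp add: inner_diff_right inner_diff_left axis_inner_axis_real)
  then have "?w \<noteq> 0" by auto
  then have S0: "?S \<noteq> {0}" using wS by blast
  have one: "?A *v ?one = valency G *\<^sub>R ?one"
    by (simp add: vec_eq_iff adjacency_mult card_neighbours del: One_nat_def)
  have inv: "?A *v v \<in> ?S" if "v \<in> ?S" for v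
    using symmetric_matrix_inner[OF adjacency_symmetric, of ?one v] that by (simp add: one)
  obtain v \<theta> where v: "v \<in> ?S" "norm v = 1" "?A *v v = \<theta> *\<^sub>R v"
      "\<And>w. w \<in> ?S \<Longrightarrow> w \<bullet> (?A *v w) \<le> \<theta> * (w \<bullet> w)"
    by (rule symmetric_matrix_max_eigenvector[OF adjacency_symmetric S S0 inv]) (assumption | rule that)+
  have "v \<noteq> 0" using v(2) by auto
  have "\<theta> \<in> eigenvalues G" unfolding eigenvalues_def using v(3) \<open>v \<noteq> 0\<close> by blast
  moreover have "\<theta> \<noteq> valency G"
  proof
    assume \<theta>: "\<theta> = valency G"
    obtain x' where x': "\<And>y. \<bar>v $ y\<bar> \<le> \<bar>v $ x'\<bar>" and nz: "v $ x' \<noteq> 0"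
      by (rule max_abs_entry[OF \<open>v \<noteq> 0\<close>]) (rule that)
    have "v $ y = v $ x'" for y
      using extreme_eigenvector[of v 1 x' y] v(3) \<theta> x' nz by simp
    then have "(\<Sum>y\<in>UNIV. v $ y) = (\<Sum>y\<in>(UNIV :: 'v set). v $ x')"
      by (intro sum.cong refl)
    then have "?one \<bullet> v = CARD('v) * v $ x'" by (simp add: inner_vec_def)
    then show False using v(1) nz by simp
  qed
  moreover have "0 \<le> \<theta>"
  proof -
    have "?w \<bullet> (?A *v ?w) = 0"
      using xy ne dist_commute[of y x]
      by (simp add: inner_diff_left inner_diff_right matrix_vector_mult_diff_distrib adjacency_axis_inner)
    then show ?thesis using v(4)[OF wS] ww by simp
  qed
  ultimately show ?thesis using eigenvalue_le_second by (metis order_trans)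
qed

text \<open>
  The vector that is 1 at the ends and -1 in the middle of an induced path with three vertices has
  Rayleigh quotient -4/3.
\<close>

lemma last_eigenvalue_less: "nth_eigenvalue G d < - 1"
proof -
  let ?A = "- adjacency_matrix G"
  obtain x y where xy: "D x y = 2" using dist_attained[OF diam_ge_2] .
  obtain z where z: "D x z = 1" "D z y = 1" using step_towards[of x y 1] xy by auto
  have ne: "x \<noteq> y" "x \<noteq> z" "y \<noteq> z" using xy z by auto
  let ?w = "axis x 1 + axis y 1 - axis z 1 :: real^'v"
  have sym: "transpose ?A = ?A"
    using adjacency_symmetric by (simp add: transpose_def vec_eq_iff)
  have S0: "(UNIV :: (real^'v) set) \<noteq> {0}" by (metis UNIV_I singletonD axis_eq_0_iff zero_neq_one)
  have mult: "?A *v v = - (adjacency_matrix G *v v)" for v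
    by (simp add: vec_eq_iff matrix_vector_mult_def sum_negf)
  obtain v \<theta> where v: "norm v = 1" "?A *v v = \<theta> *\<^sub>R v"
      "\<And>w. w \<in> UNIV \<Longrightarrow> w \<bullet> (?A *v w) \<le> \<theta> * (w \<bullet> w)"
    by (rule symmetric_matrix_max_eigenvector[OF sym subspace_UNIV S0]) (rule UNIV_I, rule that)
  have "v \<noteq> 0" using v(1) by auto
  have "adjacency_matrix G *v v = (- \<theta>) *\<^sub>R v" using v(2) unfolding mult by (simp add: minus_equation_iff)
  then have "- \<theta> \<in> eigenvalues G" unfolding eigenvalues_def using \<open>v \<noteq> 0\<close> by blast
  then have "nth_eigenvalue G d \<le> - \<theta>" by (rule eigenvalue_ge_last)
  moreover have "?w \<bullet> ?w = 3"
    using ne by (simp add: inner_diff_right inner_diff_left inner_add_left inner_add_right axis_inner_axis_real)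
  moreover have "?w \<bullet> (?A *v ?w) = 4"
    using xy z ne dist_commute[of y x] dist_commute[of z x] dist_commute[of y z]
    by (simp add: mult inner_diff_left inner_diff_right inner_add_left inner_add_right
        matrix_vector_mult_diff_distrib matrix_vector_right_distrib adjacency_axis_inner)
  ultimately show ?thesis using v(3)[of ?w] by simp
qed

end

section \<open>The Gram matrix of an edge and its common neighbours\<close>

text \<open>
  The left side will be the quadratic form at \<open>t = a s / (1 + s)\<close>, the value that minimises it. The
  recurrence at 1 removes \<open>s2\<close> and makes the nontrivial part affine in \<open>e\<close>.
\<close>

lemma gram_determinant_factor:
  fixes a b k e s s2 t :: "'a::field"
  assumes k: "k = 1 + a + b" and s2: "b * (s - s2) = (1 - s) * (1 + k * s)"
    and t: "t * (1 + s) = a * s"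
  shows "b * (1 + s) * (a\<^sup>2 * s2 + a * (1 - s2) + e * (s - s2) - 4 * t * a * s + t\<^sup>2 * (2 + 2 * s))
    = (1 - s) * (a * b * (1 + (1 + a) * s) + (e - a\<^sup>2 + a) * (1 + k * s) * (1 + s))"
proof -
  have "(1 + s) * (t\<^sup>2 * (2 + 2 * s) - 4 * t * a * s)
      = 2 * (t * (1 + s))\<^sup>2 - 4 * a * s * (t * (1 + s))"
    by (simp add: power2_eq_square algebra_simps)
  then have tt: "(1 + s) * (t\<^sup>2 * (2 + 2 * s) - 4 * t * a * s) = - 2 * a\<^sup>2 * s\<^sup>2"
    unfolding t by (simp add: power2_eq_square)
  have bs: "b * s2 = b * s - (1 - s) * (1 + k * s)" using s2 by (simp add: algebra_simps)
  have "b * (1 + s) * (a\<^sup>2 * s2 + a * (1 - s2) + e * (s - s2) - 4 * t * a * s + t\<^sup>2 * (2 + 2 * s))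
    = (1 + s) * ((a\<^sup>2 - a) * (b * s2) + a * b + e * (b * (s - s2)))
      + b * ((1 + s) * (t\<^sup>2 * (2 + 2 * s) - 4 * t * a * s))"
    by (simp add: algebra_simps)
  also have "\<dots> = (1 - s) * (a * b * (1 + (1 + a) * s) + (e - a\<^sup>2 + a) * (1 + k * s) * (1 + s))"
    unfolding tt bs s2 by (simp add: algebra_simps power2_eq_square)
  finally show ?thesis .
qed

text \<open>
  Eliminates \<open>e\<close> between the expressions for two eigenvalues.
\<close>

lemma gram_combination:
  fixes a b k e s r :: "'a::field"
  assumes k: "k = 1 + a + b"
  defines "q \<equiv> \<lambda>s. a * b * (1 + (1 + a) * s) + (e - a\<^sup>2 + a) * (1 + k * s) * (1 + s)"
  shows "(1 + k * s) * (1 + s) * q r - (1 + k * r) * (1 + r) * q s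
    = a * b * (s - r) * (k - a + k * (s + r) + (1 + a) * k * s * r)"
  unfolding q_def k by (simp add: algebra_simps power2_eq_square)

context drg begin

abbreviation k :: real where "k \<equiv> real (valency G)"
abbreviation a1 :: real where "a1 \<equiv> real (a_num G 1)"
abbreviation b1 :: real where "b1 \<equiv> real (b_num G 1)"

definition triangle_vertices :: "'v \<Rightarrow> 'v \<Rightarrow> 'v set" where
  "triangle_vertices x y = {z. D x z = 1 \<and> D z y = 1}"

text \<open>
  With \<open>t\<close> chosen as the projection coefficient, the profile matrix maps this vector to 0 exactly when
  the projections of \<open>x\<close>, \<open>y\<close> and the sum of their common neighbours are dependent.
\<close>

definition edge_vector :: "'v \<Rightarrow> 'v \<Rightarrow> real \<Rightarrow> real^'v" where
  "edge_vector x y t = (\<Sum>z\<in>triangle_vertices x y. axis z 1) - t *\<^sub>R (axis x 1 + axis y 1)"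

text \<open>
  Twice the number of edges among the common neighbours, the one quantity of an edge that the
  intersection numbers do not determine.
\<close>

definition local_adjacency :: "'v \<Rightarrow> 'v \<Rightarrow> real" where
  "local_adjacency x y = (\<Sum>z\<in>triangle_vertices x y. \<Sum>w\<in>triangle_vertices x y. if D z w = 1 then 1 else 0)"

lemma card_triangle_vertices: "D x y = 1 \<Longrightarrow> card (triangle_vertices x y) = a_num G 1"
  using card_a[of x y] by (simp add: triangle_vertices_def)

lemma profile_edge_vector:
  "(profile_matrix u *v edge_vector x y t) $ p =
    (\<Sum>z\<in>triangle_vertices x y. u (D p z)) - t * (u (D p x) + u (D p y))"
proof -
  have "profile_matrix u *v edge_vector x y t =
    (\<Sum>z\<in>triangle_vertices x y. profile_matrix u *v axis z 1)
    - t *\<^sub>R (profile_matrix u *v axis x 1 + profile_matrix u *v axis y 1)"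
    by (simp add: edge_vector_def matrix_vector_mult_diff_distrib matrix_vector_right_distrib
        matrix_vector_mult_scaleR linear_sum[OF matrix_vector_mul_linear])
  then show ?thesis by (simp add: profile_matrix_axis)
qed

lemma inner_edge_vector:
  "edge_vector x y t \<bullet> v = (\<Sum>z\<in>triangle_vertices x y. v $ z) - t * (v $ x + v $ y)"
  by (simp add: edge_vector_def inner_diff_left inner_sum_left inner_add_left inner_axis')

text \<open>
  Common neighbours of an edge have distance at most 2 from each other.
\<close>

lemma triangle_vertices_sum:
  assumes xy: "D x y = 1"
  shows "(\<Sum>z\<in>triangle_vertices x y. \<Sum>w\<in>triangle_vertices x y. u (D z w))
    = a1\<^sup>2 * u 2 + a1 * (u 0 - u 2) + local_adjacency x y * (u 1 - u 2)"
proof -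
  let ?\<Delta> = "triangle_vertices x y"
  have "u (D z w) = u 2 + (if z = w then u 0 - u 2 else 0) + (if D z w = 1 then 1 else 0) * (u 1 - u 2)"
    if "z \<in> ?\<Delta>" "w \<in> ?\<Delta>" for z w
  proof -
    have "D z w \<le> 2"
      using that dist_triangle[of z w x] dist_commute[of z x] by (simp add: triangle_vertices_def)
    then consider "D z w = 0" | "D z w = 1" | "D z w = 2" by linarith
    then show ?thesis by cases auto
  qed
  then have "(\<Sum>z\<in>?\<Delta>. \<Sum>w\<in>?\<Delta>. u (D z w)) = (\<Sum>z\<in>?\<Delta>. \<Sum>w\<in>?\<Delta>. u 2
      + (if z = w then u 0 - u 2 else 0) + (if D z w = 1 then 1 else 0) * (u 1 - u 2))"
    by (intro sum.cong refl)
  also have "\<dots> = a1 * (a1 * u 2) + a1 * (u 0 - u 2) + local_adjacency x y * (u 1 - u 2)"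
    by (simp add: sum.distrib card_triangle_vertices[OF xy] local_adjacency_def sum_distrib_right
        distrib_left del: One_nat_def)
  finally show ?thesis by (simp add: power2_eq_square)
qed

lemma edge_gram:
  assumes xy: "D x y = 1" and u0: "u 0 = 1"
  shows "edge_vector x y t \<bullet> (profile_matrix u *v edge_vector x y t) =
    a1\<^sup>2 * u 2 + a1 * (1 - u 2) + local_adjacency x y * (u 1 - u 2) - 4 * t * a1 * u 1 + t\<^sup>2 * (2 + 2 * u 1)"
proof -
  let ?\<Delta> = "triangle_vertices x y"
  have D1: "D z x = 1" "D x z = 1" "D z y = 1" "D y z = 1" if "z \<in> ?\<Delta>" for z
    using that dist_commute[of z x] dist_commute[of y z] by (auto simp: triangle_vertices_def)
  have "(\<Sum>z\<in>?\<Delta>. u (D x z)) = (\<Sum>z\<in>?\<Delta>. u 1)" "(\<Sum>z\<in>?\<Delta>. u (D y z)) = (\<Sum>z\<in>?\<Delta>. u 1)"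
    by (intro sum.cong refl; simp only: D1)+
  moreover have "(\<Sum>z\<in>?\<Delta>. (\<Sum>w\<in>?\<Delta>. u (D z w)) - t * (u (D z x) + u (D z y))) =
     (\<Sum>z\<in>?\<Delta>. (\<Sum>w\<in>?\<Delta>. u (D z w)) - t * (u 1 + u 1))"
    by (intro sum.cong refl) (simp only: D1)
  ultimately show ?thesis
    using xy dist_commute[of y x]
    by (simp add: inner_edge_vector profile_edge_vector sum_subtractf triangle_vertices_sum[OF xy]
        card_triangle_vertices[OF xy] u0 algebra_simps power2_eq_square del: One_nat_def)
qed

lemma three_term_0:
  fixes u :: "nat \<Rightarrow> 'a::real_field"
  assumes "three_term \<theta> u" "u 0 = 1"
  shows "\<theta> = of_nat (valency G) * u 1"
  using three_termD[OF assms(1), of 0] assms(2) by (simp add: valency_def)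

lemma k_eq: "k = 1 + a1 + b1"
  using cab_sum[of 1] diam_ge_2 c_1 by (simp flip: of_nat_add del: One_nat_def)

lemma three_term_1:
  fixes u :: "nat \<Rightarrow> real"
  assumes "three_term \<theta> u" "u 0 = 1"
  shows "b1 * (u 1 - u 2) = (1 - u 1) * (1 + k * u 1)"
proof -
  have "1 + a1 * u 1 + b1 * u 2 = k * u 1 * u 1"
    using three_termD[OF assms(1), of 1] diam_ge_2 c_1 assms(2) three_term_0[OF assms]
    by (simp add: numeral_2_eq_2)
  moreover have "b1 * u 1 = k * u 1 - u 1 - a1 * u 1" by (simp add: k_eq algebra_simps)
  ultimately show ?thesis by (simp add: algebra_simps)
qed

text \<open>
  The factor of the quadratic form of the edge vector that decides its sign.
\<close>

definition edge_form :: "'v \<Rightarrow> 'v \<Rightarrow> real \<Rightarrow> real" where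
  "edge_form x y s = a1 * b1 * (1 + (1 + a1) * s)
     + (local_adjacency x y - a1\<^sup>2 + a1) * (1 + k * s) * (1 + s)"

lemma edge_gram_factor:
  fixes u :: "nat \<Rightarrow> real"
  assumes xy: "D x y = 1" and u: "three_term \<theta> u" "u 0 = 1" and "1 + u 1 \<noteq> 0"
  defines "w \<equiv> edge_vector x y (a1 * u 1 / (1 + u 1))"
  shows "b1 * (1 + u 1) * (w \<bullet> (profile_matrix u *v w)) = (1 - u 1) * edge_form x y (u 1)"
  unfolding w_def edge_gram[where u = u, OF xy u(2)] edge_form_def
  by (rule gram_determinant_factor[OF k_eq three_term_1[OF u]]) (use assms(4) in simp)

lemma b1_pos: "0 < b1"
  using b_pos[of 1] diam_ge_2 by simp

lemma edge_form_nonneg: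
  fixes u :: "nat \<Rightarrow> real"
  assumes xy: "D x y = 1" and u: "three_term \<theta> u" "u 0 = 1" and "- 1 < u 1" "u 1 < 1"
  shows "0 \<le> edge_form x y (u 1)"
proof -
  have "1 + u 1 \<noteq> 0" using assms(4) by simp
  let ?w = "edge_vector x y (a1 * u 1 / (1 + u 1))"
  have "0 \<le> b1 * (1 + u 1) * (?w \<bullet> (profile_matrix u *v ?w))"
    using b1_pos assms(4) profile_psd[OF u] by (intro mult_nonneg_nonneg) simp_all
  then have "0 \<le> (1 - u 1) * edge_form x y (u 1)"
    unfolding edge_gram_factor[OF xy u \<open>1 + u 1 \<noteq> 0\<close>] .
  then show ?thesis using assms(5) by (simp add: zero_le_mult_iff)
qed

lemma edge_form_eq_0:
  fixes u :: "nat \<Rightarrow> real"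
  assumes xy: "D x y = 1" and u: "three_term \<theta> u" "u 0 = 1" and "1 + u 1 \<noteq> 0"
    and "edge_form x y (u 1) = 0"
  shows "(1 + u 1) * (\<Sum>z\<in>triangle_vertices x y. u (D p z)) = a1 * u 1 * (u (D p x) + u (D p y))"
proof -
  let ?w = "edge_vector x y (a1 * u 1 / (1 + u 1))"
  have "?w \<bullet> (profile_matrix u *v ?w) = 0"
    using edge_gram_factor[OF xy u assms(4)] b1_pos assms(4,5) by simp
  then have "profile_matrix u *v ?w = 0" by (rule profile_psd_eq_0[OF u])
  then have "(profile_matrix u *v ?w) $ p = 0" by simp
  then show ?thesis using assms(4) unfolding profile_edge_vector by (simp add: field_simps)
qed

text \<open>
  Up to the positive factor \<open>k / (a\<^sub>1 + 1)\<close>, the difference of the two sides of the equation that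
  defines tightness, for the eigenvalues \<open>k s\<close> and \<open>k r\<close> (see \<open>tight_form_bound\<close>).
\<close>

definition tight_form :: "real \<Rightarrow> real \<Rightarrow> real" where
  "tight_form s r = k - a1 + k * (s + r) + (1 + a1) * k * s * r"

lemma tight_form_commute: "tight_form s r = tight_form r s"
  by (simp add: tight_form_def algebra_simps)

lemma tight_form_bound:
  "(k * s + k / (a1 + 1)) * (k * r + k / (a1 + 1)) = - (k * a1 * b1) / (a1 + 1)\<^sup>2 + k / (a1 + 1) * tight_form s r"
proof -
  define m where "m = a1 + 1"
  have m: "m \<noteq> 0" "a1 = m - 1" "b1 = k - m" using k_eq by (simp_all add: m_def)
  show ?thesis unfolding tight_form_def m(2,3) using m(1)
    by (simp add: field_simps power2_eq_square)
qed

lemma edge_form_combination: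
  "(1 + k * s) * (1 + s) * edge_form x y r - (1 + k * r) * (1 + r) * edge_form x y s
    = a1 * b1 * (s - r) * tight_form s r"
  unfolding edge_form_def tight_form_def by (rule gram_combination[OF k_eq])

text \<open>
  The fundamental bound. The signs of \<open>1 + k s\<^sub>1\<close> and \<open>1 + k r\<^sub>1\<close> are opposite, so in the combination
  that eliminates the local adjacency both edge forms occur with nonnegative coefficients; equality
  therefore forces both of them to vanish.
\<close>

lemma tight_form_nonneg:
  fixes s r :: "nat \<Rightarrow> real"
  assumes s: "three_term \<theta> s" "s 0 = 1" "s 1 < 1" "0 < 1 + k * s 1"
    and r: "three_term \<theta>' r" "r 0 = 1" "- 1 < r 1" "1 + k * r 1 < 0"
  shows "0 \<le> tight_form (s 1) (r 1)"
    and "\<lbrakk>tight_form (s 1) (r 1) = 0; D x y = 1\<rbrakk> \<Longrightarrow> edge_form x y (s 1) = 0 \<and> edge_form x y (r 1) = 0"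
proof -
  have k1: "0 < k" using valency_pos by simp
  have rs: "r 1 < s 1"
  proof -
    have "k * r 1 < k * s 1" using s(4) r(4) by linarith
    then show ?thesis using k1 by simp
  qed
  have s1: "- 1 < s 1" "r 1 < 1" using rs r(3) s(3) by auto
  have pos: "0 < (1 + k * s 1) * (1 + s 1)" "0 < - ((1 + k * r 1) * (1 + r 1))"
    using s(4) s1 r(3,4) by (simp_all add: mult_neg_pos)
  have main: "0 \<le> (1 + k * s 1) * (1 + s 1) * edge_form x y (r 1)"
      "0 \<le> - ((1 + k * r 1) * (1 + r 1)) * edge_form x y (s 1)" if "D x y = 1" for x y
    using edge_form_nonneg[OF that s(1,2) s1(1) s(3)] edge_form_nonneg[OF that r(1,2,3) s1(2)] pos
    by (simp_all only: mult_nonneg_nonneg less_imp_le)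
  have comb: "(1 + k * s 1) * (1 + s 1) * edge_form x y (r 1)
      + - ((1 + k * r 1) * (1 + r 1)) * edge_form x y (s 1) = a1 * b1 * (s 1 - r 1) * tight_form (s 1) (r 1)" for x y
    using edge_form_combination[of "s 1" x y "r 1"] by simp
  show "0 \<le> tight_form (s 1) (r 1)"
  proof (cases "a1 = 0")
    case True
    then have "tight_form (s 1) (r 1) = k * ((1 + s 1) * (1 + r 1))"
      unfolding tight_form_def True by (simp add: algebra_simps)
    then show ?thesis using k1 s1 r(3) by simp
  next
    case False
    obtain x y where xy: "D x y = 1" using dist_attained[of 1] diam_ge_2 by auto
    have "0 \<le> a1 * b1 * (s 1 - r 1) * tight_form (s 1) (r 1)"
      using main[OF xy] unfolding comb[of x y, symmetric] by linarith
    moreover have "0 < a1 * b1 * (s 1 - r 1)" using False b1_pos rs by simp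
    ultimately show ?thesis by (simp add: zero_le_mult_iff)
  qed
  assume T: "tight_form (s 1) (r 1) = 0" and xy: "D x y = 1"
  have "(1 + k * s 1) * (1 + s 1) * edge_form x y (r 1) = 0"
      "- ((1 + k * r 1) * (1 + r 1)) * edge_form x y (s 1) = 0"
    using main[OF xy] comb[of x y] unfolding T by linarith+
  then show "edge_form x y (s 1) = 0 \<and> edge_form x y (r 1) = 0"
    using pos by auto
qed

text \<open>
  Two consecutive zeros would propagate down to the index 0.
\<close>

lemma three_term_consecutive_zeros:
  fixes u :: "nat \<Rightarrow> 'a::real_field"
  assumes u: "three_term \<theta> u" "u 0 = 1" and "i < d" "u i = 0" "u (Suc i) = 0"
  shows False
  using assms(3-5)
proof (induction i)
  case 0
  then show ?case using u(2) by simp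
next
  case (Suc i)
  then have "of_nat (c_num G (Suc i)) * u i = 0"
    using three_termD[OF u(1), of "Suc i"] by simp
  then have "u i = 0" using c_pos[of "Suc i"] Suc.prems(1) by simp
  then show ?case using Suc by simp
qed

text \<open>
  When the edge forms vanish, the dependence of the projected vectors determines the number of common
  neighbours of an edge \<open>xy\<close> at distance \<open>i\<close> from \<open>p\<close> by either cosine sequence. Equating the two
  answers gives the relation. If two consecutive cosines agreed, the dependence would make both
  of them 0.
\<close>

lemma tight_cosine_relation:
  fixes s r :: "nat \<Rightarrow> real"
  assumes s: "three_term \<theta> s" "s 0 = 1" "s 1 < 1" "0 < 1 + k * s 1"
    and r: "three_term \<theta>' r" "r 0 = 1" "- 1 < r 1" "1 + k * r 1 < 0"
    and T: "tight_form (s 1) (r 1) = 0" and i: "i < d"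
  shows "(s 1 - r 1) * (s (Suc i) * r (Suc i) - s i * r i) = (1 - s 1 * r 1) * (s i * r (Suc i) - s (Suc i) * r i)"
    and "s i \<noteq> s (Suc i)" "r i \<noteq> r (Suc i)"
proof -
  have k1: "0 < k" using valency_pos by simp
  have "k * r 1 < k * s 1" using s(4) r(4) by linarith
  then have rs: "r 1 < s 1" using k1 by simp
  have ne: "1 + s 1 \<noteq> 0" "1 + r 1 \<noteq> 0" using r(3) rs by auto
  have "a1 \<noteq> 0"
  proof
    assume a: "a1 = 0"
    have "tight_form (s 1) (r 1) = k * ((1 + s 1) * (1 + r 1))"
      unfolding tight_form_def a by (simp add: algebra_simps)
    then show False using T k1 ne by simp
  qed
  \<comment> \<open>Common neighbours of the edge \<open>xy\<close> are at distance \<open>i\<close> or \<open>i + 1\<close> from \<open>p\<close>; the number \<open>n\<close> of the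
    former is the same for every cosine sequence.\<close>
  obtain x p where xp: "D x p = Suc i" using dist_attained[of "Suc i"] i by auto
  obtain y where y: "D x y = 1" "D y p = i" using step_towards[OF xp] .
  let ?\<Delta> = "triangle_vertices x y"
  define n where "n = real (card {z \<in> ?\<Delta>. D p z = i})"
  have count: "(\<Sum>z\<in>?\<Delta>. u (D p z)) = n * u i + (a1 - n) * u (Suc i)" for u :: "nat \<Rightarrow> real"
  proof -
    have cases: "D p z = i \<or> D p z = Suc i" if "z \<in> ?\<Delta>" for z
    proof -
      have "D x z = 1" "D y z = 1" using that dist_commute[of z y] by (auto simp: triangle_vertices_def)
      then show ?thesis
        using dist_adj_cases[of x z p] dist_adj_cases[of y z p] xp y(2) dist_commute[of z p] by linarith
    qed
    have "(\<Sum>z\<in>?\<Delta>. u (D p z)) = (\<Sum>z\<in>?\<Delta>. u (Suc i) + (if D p z = i then u i - u (Suc i) else 0))"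
    proof (intro sum.cong refl)
      show "u (D p z) = u (Suc i) + (if D p z = i then u i - u (Suc i) else 0)" if "z \<in> ?\<Delta>" for z
        using cases[OF that] by auto
    qed
    also have "\<dots> = a1 * u (Suc i) + n * (u i - u (Suc i))"
      by (simp add: sum.distrib card_triangle_vertices[OF y(1)] n_def sum.If_cases Int_def del: One_nat_def)
    finally show ?thesis by (simp add: algebra_simps)
  qed
  have rel: "n * (1 + u 1) * (u i - u (Suc i)) = a1 * (u 1 * u i - u (Suc i))"
    if "three_term \<eta> u" "u 0 = 1" "1 + u 1 \<noteq> 0" "edge_form x y (u 1) = 0" for u \<eta>
    using edge_form_eq_0[OF y(1) that, of p] xp y(2) dist_commute[of p x] dist_commute[of p y]
    unfolding count by (simp add: algebra_simps)
  have E: "edge_form x y (s 1) = 0" "edge_form x y (r 1) = 0"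
    using tight_form_nonneg(2)[OF s r T y(1)] by auto
  have neq: "u i \<noteq> u (Suc i)"
    if "three_term \<eta> u" "u 0 = 1" "1 + u 1 \<noteq> 0" "edge_form x y (u 1) = 0" "u 1 \<noteq> 1" for u \<eta>
  proof
    assume eq: "u i = u (Suc i)"
    then have "a1 * ((u 1 - 1) * u (Suc i)) = 0" using rel[OF that(1-4)] by (simp add: algebra_simps)
    then have "u (Suc i) = 0" using \<open>a1 \<noteq> 0\<close> that(5) by simp
    then show False using three_term_consecutive_zeros[OF that(1,2) i] eq by simp
  qed
  show "s i \<noteq> s (Suc i)" by (rule neq[OF s(1,2) ne(1) E(1)]) (use s(3) in simp)
  show "r i \<noteq> r (Suc i)" by (rule neq[OF r(1,2) ne(2) E(2)]) (use s(3) rs in simp)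
  have "a1 * ((s 1 * s i - s (Suc i)) * ((1 + r 1) * (r i - r (Suc i)))
      - (r 1 * r i - r (Suc i)) * ((1 + s 1) * (s i - s (Suc i)))) =
    (a1 * (s 1 * s i - s (Suc i))) * ((1 + r 1) * (r i - r (Suc i)))
    - (a1 * (r 1 * r i - r (Suc i))) * ((1 + s 1) * (s i - s (Suc i)))"
    by (simp add: algebra_simps)
  also have "\<dots> = 0"
    unfolding rel[OF s(1,2) ne(1) E(1), symmetric] rel[OF r(1,2) ne(2) E(2), symmetric] by simp
  finally have "(s 1 * s i - s (Suc i)) * ((1 + r 1) * (r i - r (Suc i)))
      - (r 1 * r i - r (Suc i)) * ((1 + s 1) * (s i - s (Suc i))) = 0"
    using \<open>a1 \<noteq> 0\<close> by simp
  then show "(s 1 - r 1) * (s (Suc i) * r (Suc i) - s i * r i) = (1 - s 1 * r 1) * (s i * r (Suc i) - s (Suc i) * r i)"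
    by (simp add: algebra_simps)
qed

end

section \<open>Solving for the intersection numbers\<close>

text \<open>
  Here \<open>p, q, w\<close> and \<open>p', q', w'\<close> stand for three consecutive cosines of the two eigenvalues. The cross
  relations express \<open>p'\<close> and \<open>w'\<close> as multiples of \<open>q'\<close>, after which both recurrences are
  linear equations for \<open>B\<close> and \<open>C\<close> with coefficients in \<open>p, q, w, \<epsilon>\<close>. The formula for \<open>C\<close> is the
  instance with \<open>p\<close> and \<open>w\<close> exchanged.
\<close>

lemma solve_two_recurrences:
  fixes k h s r \<epsilon> B C p q w p' q' w' :: "'a::field"
  assumes eps: "\<epsilon> * (s - r) = 1 - s * r" and h: "h * (1 + s) = k * (s - r)"
    and ne: "s \<noteq> r" "s \<noteq> 1" "r \<noteq> 1" "1 + s \<noteq> 0" "1 + r \<noteq> 0"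
    and cross_p: "(s - r) * (q * q' - p * p') = (1 - s * r) * (p * q' - q * p')"
    and cross_w: "(s - r) * (w * w' - q * q') = (1 - s * r) * (q * w' - w * q')"
    and rec: "C * (p - q) + B * (w - q) = k * (s - 1) * q"
    and rec': "C * (p' - q') + B * (w' - q') = k * (r - 1) * q'"
    and nz: "\<not> (p = 0 \<and> q = 0)" "\<not> (q = 0 \<and> w = 0)" "\<not> (p' = 0 \<and> q' = 0)" "\<not> (q' = 0 \<and> w' = 0)"
    and pw: "p \<noteq> w"
  shows "B * ((p - w) * (w - q)) = h * ((p - s * q) * (w - \<epsilon> * q))"
proof -
  define P W where "P = p - \<epsilon> * q" and "W = w - \<epsilon> * q"
  have "(s - r) * (q * q' - p * p') = (s - r) * (\<epsilon> * (p * q' - q * p'))"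
    unfolding cross_p eps[symmetric] by simp
  then have "q * q' - p * p' = \<epsilon> * (p * q' - q * p')" using ne(1) by simp
  then have relP: "p' * P = q' * (q - \<epsilon> * p)" by (simp add: P_def algebra_simps)
  have "(s - r) * (w * w' - q * q') = (s - r) * (\<epsilon> * (q * w' - w * q'))"
    unfolding cross_w eps[symmetric] by simp
  then have "w * w' - q * q' = \<epsilon> * (q * w' - w * q')" using ne(1) by simp
  then have relW: "w' * W = q' * (q - \<epsilon> * w)" by (simp add: W_def algebra_simps)
  have "(\<epsilon> - 1) * (s - r) = (1 - s) * (1 + r)" "(\<epsilon> + 1) * (s - r) = (1 + s) * (1 - r)"
    using eps by (simp_all add: algebra_simps)
  then have "\<epsilon> - 1 \<noteq> 0" "\<epsilon> + 1 \<noteq> 0" and eps1: "(1 + \<epsilon>) * (s - r) = (1 + s) * (1 - r)"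
    using ne by (auto simp: add.commute)
  moreover have "1 - \<epsilon> * \<epsilon> = - ((\<epsilon> - 1) * (\<epsilon> + 1))" by (simp add: algebra_simps)
  ultimately have eps2: "1 - \<epsilon> * \<epsilon> \<noteq> 0" by simp
  \<comment> \<open>Two consecutive terms are never both 0. With \<open>p \<noteq> w\<close> this excludes \<open>q' = 0\<close>, and with \<open>\<epsilon>\<^sup>2 \<noteq> 1\<close> it
    excludes \<open>P = 0\<close> and \<open>W = 0\<close>.\<close>
  have "q' \<noteq> 0"
  proof
    assume "q' = 0"
    then have "P = 0" "W = 0" using relP relW nz(3,4) by auto
    then show False using pw by (simp add: P_def W_def)
  qed
  have "P \<noteq> 0"
  proof
    assume "P = 0"
    then have *: "p = \<epsilon> * q" "q = \<epsilon> * p" using relP \<open>q' \<noteq> 0\<close> by (simp_all add: P_def)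
    then have "(1 - \<epsilon> * \<epsilon>) * p = 0" by (simp add: algebra_simps)
    then have "p = 0" using eps2 by simp
    then show False using *(2) nz(1) by simp
  qed
  have "W \<noteq> 0"
  proof
    assume "W = 0"
    then have *: "w = \<epsilon> * q" "q = \<epsilon> * w" using relW \<open>q' \<noteq> 0\<close> by (simp_all add: W_def)
    then have "(1 - \<epsilon> * \<epsilon>) * w = 0" by (simp add: algebra_simps)
    then have "w = 0" using eps2 by simp
    then show False using *(2) nz(2) by simp
  qed
  have "C * (p' * P - q' * P) * W + B * (w' * W - q' * W) * P = (C * (p' - q') + B * (w' - q')) * P * W"
    by (simp add: algebra_simps)
  also have "\<dots> = k * (r - 1) * q' * P * W" unfolding rec' by simp
  finally have "q' * ((1 + \<epsilon>) * (C * (q - p) * W + B * (q - w) * P)) = q' * (k * (r - 1) * P * W)"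
    unfolding relP relW by (simp add: P_def W_def algebra_simps)
  then have "(1 + \<epsilon>) * (C * (q - p) * W + B * (q - w) * P) = k * (r - 1) * P * W"
    using \<open>q' \<noteq> 0\<close> by simp
  moreover have "C * (q - p) = B * (w - q) - k * (s - 1) * q" using rec by (simp add: algebra_simps)
  ultimately have "(1 + \<epsilon>) * ((B * (w - q) - k * (s - 1) * q) * W + B * (q - w) * P) = k * (r - 1) * P * W"
    by simp
  then have "((1 + \<epsilon>) * (s - r)) * ((B * (w - q) - k * (s - 1) * q) * W + B * (q - w) * P)
      = (s - r) * (k * (r - 1) * P * W)"
    by simp
  then have "(1 - r) * ((1 + s) * ((B * (w - q) - k * (s - 1) * q) * W + B * (q - w) * P))
      = (1 - r) * (- (s - r) * k * P * W)"
    unfolding eps1 by (simp add: algebra_simps)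
  then have "(1 + s) * ((B * (w - q) - k * (s - 1) * q) * W + B * (q - w) * P) = - (s - r) * k * P * W"
    using ne(3) by simp
  moreover have "(B * (w - q) - k * (s - 1) * q) * W + B * (q - w) * P
      = B * (w - q) * (W - P) - k * (s - 1) * q * W"
    by (simp add: algebra_simps)
  moreover have "W - P = w - p" by (simp add: P_def W_def)
  ultimately have "(1 + s) * (B * (w - q) * (w - p) - k * (s - 1) * q * W) = - (s - r) * k * P * W"
    by simp
  then have "(1 + s) * (B * ((p - w) * (w - q))) = k * W * ((s - r) * P + (1 - s) * (1 + s) * q)"
    by (simp add: algebra_simps)
  also have "(s - r) * P = (s - r) * p - (1 - s * r) * q"
    unfolding P_def eps[symmetric] by (simp add: algebra_simps)
  also have "(s - r) * p - (1 - s * r) * q + (1 - s) * (1 + s) * q = (s - r) * (p - s * q)"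
    by (simp add: algebra_simps)
  also have "k * W * ((s - r) * (p - s * q)) = (h * (1 + s)) * W * (p - s * q)"
    unfolding h by simp
  finally have "(1 + s) * (B * ((p - w) * (w - q))) = (1 + s) * (h * ((p - s * q) * W))"
    by (simp add: mult_ac)
  then show ?thesis using ne(4) by (simp add: W_def)
qed

text \<open>
  At the index \<open>d\<close> there is one unknown and there are two equations; together with the cross relation
  they leave only \<open>C = k\<close>, that is, \<open>a\<^sub>d = 0\<close>.
\<close>

lemma solve_last_recurrences:
  fixes k s r C p q p' q' :: "'a::field"
  assumes ne: "s \<noteq> r" "p \<noteq> q" "p' \<noteq> q'" "k \<noteq> 0"
    and cross: "(s - r) * (q * q' - p * p') = (1 - s * r) * (p * q' - q * p')"
    and rec: "C * (p - q) = k * (s - 1) * q" and rec': "C * (p' - q') = k * (r - 1) * q'"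
  shows "C = k" "p = s * q"
proof -
  have P: "k * (p - s * q) = (k - C) * (p - q)" using rec by (simp add: algebra_simps)
  have P': "k * (p' - r * q') = (k - C) * (p' - q')" using rec' by (simp add: algebra_simps)
  have "(p - s * q) * ((1 + r) * (p' - q')) = (p' - r * q') * ((1 + s) * (p - q))"
    using cross by (simp add: algebra_simps)
  then have "(k * (p - s * q)) * ((1 + r) * (p' - q')) = (k * (p' - r * q')) * ((1 + s) * (p - q))"
    by simp
  then have "(k - C) * ((r - s) * ((p - q) * (p' - q'))) = 0"
    unfolding P P' by (simp add: algebra_simps)
  then show C: "C = k" using ne by simp
  show "p = s * q" using P ne(4) unfolding C by simp
qed

text \<open>
  The cross relation at the index 1 becomes the tightness equation once \<open>s2\<close> and \<open>r2\<close> are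
  eliminated with the recurrences.
\<close>

lemma tight_form_from_relation:
  fixes a b k s r s2 r2 :: "'a::field"
  assumes k: "k = 1 + a + b" and s2: "b * (s - s2) = (1 - s) * (1 + k * s)"
    and r2: "b * (r - r2) = (1 - r) * (1 + k * r)"
    and ne: "s \<noteq> 1" "r \<noteq> 1" "s \<noteq> r"
    and cross: "(s - r) * (s2 * r2 - s * r) = (1 - s * r) * (s * r2 - s2 * r)"
  shows "k - a + k * (s + r) + (1 + a) * k * s * r = 0"
proof -
  have s': "b * (s * s - s2) = (1 - s) * (1 + (1 + a) * s)"
  proof -
    have "b * (s * s - s2) = b * (s - s2) - b * s * (1 - s)" by (simp add: algebra_simps)
    then show ?thesis unfolding s2 by (simp add: k algebra_simps)
  qed
  have r': "b * (r * r - r2) = (1 - r) * (1 + (1 + a) * r)"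
  proof -
    have "b * (r * r - r2) = b * (r - r2) - b * r * (1 - r)" by (simp add: algebra_simps)
    then show ?thesis unfolding r2 by (simp add: k algebra_simps)
  qed
  have "(s * s - s2) * ((1 + r) * (r - r2)) - (r * r - r2) * ((1 + s) * (s - s2)) = 0"
    using cross by (simp add: algebra_simps)
  then have "0 = b * b * ((s * s - s2) * ((1 + r) * (r - r2)) - (r * r - r2) * ((1 + s) * (s - s2)))"
    by simp
  also have "\<dots> = (b * (s * s - s2)) * ((1 + r) * (b * (r - r2))) - (b * (r * r - r2)) * ((1 + s) * (b * (s - s2)))"
    by (simp only: algebra_simps)
  also have "\<dots> = (1 - s) * (1 - r) * ((r - s) * (k - a + k * (s + r) + (1 + a) * k * s * r))"
    unfolding s' r' s2 r2 by (simp add: algebra_simps)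
  finally show ?thesis using ne by simp
qed

lemma product_of_nested_intervals:
  fixes X Y x y :: real
  assumes "0 < x" "x \<le> X" "0 < y" "y \<le> Y" "X * Y \<le> x * y"
  shows "X = x" "Y = y"
proof -
  have "x * Y \<le> X * Y" using assms by (intro mult_right_mono) auto
  then have "x * Y \<le> x * y" using assms(5) by linarith
  then show Y: "Y = y" using assms by simp
  show "X = x" using assms unfolding Y by simp
qed

context drg begin

lemma eigenvalue_strict_bounds:
  assumes "\<not> drg_bipartite G" "\<theta> \<in> eigenvalues G" "\<theta> \<noteq> k"
  shows "- k < \<theta>" "\<theta> < k"
proof -
  have "\<theta> \<noteq> - k" using eigenvalue_neg_valency_bipartite assms(1,2) by blast
  then show "- k < \<theta>" "\<theta> < k" using eigenvalue_abs_le[OF assms(2)] assms(3) by auto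
qed

definition cosine_1 :: "nat \<Rightarrow> real" where
  "cosine_1 i = poly (cosine_poly i) (nth_eigenvalue G 1)"

definition cosine_d :: "nat \<Rightarrow> real" where
  "cosine_d i = poly (cosine_poly i) (nth_eigenvalue G d)"

lemma cosine_1_props:
  shows "three_term (nth_eigenvalue G 1) cosine_1" "cosine_1 0 = 1" "cosine_1 1 < 1"
    "0 < 1 + k * cosine_1 1" "nth_eigenvalue G 1 = k * cosine_1 1"
proof -
  show t: "three_term (nth_eigenvalue G 1) cosine_1" and o: "cosine_1 0 = 1"
    using eigenvalue_three_term[OF nth_eigenvalue_in[of 1]] diam_ge_2
    unfolding cosine_1_def[abs_def] by simp_all
  show eq: "nth_eigenvalue G 1 = k * cosine_1 1" by (rule three_term_0[OF t o])
  show "0 < 1 + k * cosine_1 1" using second_eigenvalue_nonneg eq by simp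
  show "cosine_1 1 < 1" using nth_eigenvalue_ends(2) valency_pos unfolding eq by simp
qed

lemma cosine_d_props:
  assumes "\<not> drg_bipartite G"
  shows "three_term (nth_eigenvalue G d) cosine_d" "cosine_d 0 = 1" "- 1 < cosine_d 1"
    "1 + k * cosine_d 1 < 0" "nth_eigenvalue G d = k * cosine_d 1"
proof -
  show t: "three_term (nth_eigenvalue G d) cosine_d" and o: "cosine_d 0 = 1"
    using eigenvalue_three_term[OF nth_eigenvalue_in[of d]]
    unfolding cosine_d_def[abs_def] by simp_all
  show eq: "nth_eigenvalue G d = k * cosine_d 1" by (rule three_term_0[OF t o])
  show "1 + k * cosine_d 1 < 0" using last_eigenvalue_less eq by simp
  have "- k < nth_eigenvalue G d"
    using eigenvalue_strict_bounds(1)[OF assms nth_eigenvalue_in[of d]] nth_eigenvalue_ends by simp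
  then have "k * - 1 < k * cosine_d 1" unfolding eq by simp
  then show "- 1 < cosine_d 1"
    using mult_less_cancel_left_pos[of k "- 1" "cosine_d 1"] valency_pos by simp
qed

lemma tight_iff_form:
  "tight G \<longleftrightarrow> 3 \<le> d \<and> \<not> drg_bipartite G \<and> tight_form (cosine_1 1) (cosine_d 1) = 0"
proof -
  have "three_term (nth_eigenvalue G d) cosine_d" "cosine_d 0 = 1"
    using eigenvalue_three_term[OF nth_eigenvalue_in[of d]]
    unfolding cosine_d_def[abs_def] by simp_all
  from three_term_0[OF this] have eq: "nth_eigenvalue G d = k * cosine_d 1" .
  have "k / (a1 + 1) \<noteq> 0" using valency_pos by simp
  then show ?thesis
    unfolding tight_def Let_def eq cosine_1_props(5) tight_form_bound using dist_regular by auto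
qed

text \<open>
  The larger of the two eigenvalues is at most the second largest and the smaller one is at least the
  least eigenvalue. So the product on the left side of the fundamental bound can only decrease when
  they are replaced by the extreme ones, whereas the bound says that it does not.
\<close>

lemma extremal_pair:
  fixes s r :: real
  assumes bip: "\<not> drg_bipartite G"
    and s: "k * s \<in> eigenvalues G" "s \<noteq> 1" and r: "k * r \<in> eigenvalues G" "r \<noteq> 1"
    and T: "tight_form s r = 0"
  shows "tight_form (cosine_1 1) (cosine_d 1) = 0"
    and "(k * s = nth_eigenvalue G 1 \<and> k * r = nth_eigenvalue G d) \<or>
         (k * r = nth_eigenvalue G 1 \<and> k * s = nth_eigenvalue G d)"
proof -
  have k0: "0 < k" using valency_pos by simp
  have ks: "k * s \<noteq> k" "k * r \<noteq> k" using s(2) r(2) k0 by auto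
  let ?\<alpha> = "k / (a1 + 1)"
  have pm: "- 1 < u" if "k * u \<in> eigenvalues G" "k * u \<noteq> k" for u
  proof -
    have "k * - 1 < k * u" using eigenvalue_strict_bounds(1)[OF bip that] by simp
    then show ?thesis using mult_less_cancel_left_pos[OF k0] by blast
  qed
  have "a1 \<noteq> 0"
  proof
    assume a: "a1 = 0"
    have "tight_form s r = k * ((1 + s) * (1 + r))"
      unfolding tight_form_def a by (simp add: algebra_simps)
    then show False using T k0 pm[OF s(1) ks(1)] pm[OF r(1) ks(2)] by simp
  qed
  \<comment> \<open>With \<open>\<alpha> = k / (a\<^sub>1 + 1)\<close>, tightness of a pair means \<open>(\<theta> + \<alpha>) (\<theta>' + \<alpha>) = - M\<close>. As \<open>M > 0\<close>, the two
    eigenvalues lie on different sides of \<open>- \<alpha>\<close>.\<close>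
  define M where "M = (k * a1 * b1) / (a1 + 1)\<^sup>2"
  have M: "0 < M" unfolding M_def using k0 b1_pos \<open>a1 \<noteq> 0\<close> by simp
  have low: "- ((nth_eigenvalue G 1 + ?\<alpha>) * (nth_eigenvalue G d + ?\<alpha>)) = M - ?\<alpha> * tight_form (cosine_1 1) (cosine_d 1)"
    using tight_form_bound[of "cosine_1 1" "cosine_d 1"]
    unfolding cosine_1_props(5) cosine_d_props(5)[OF bip] M_def by simp
  have T0: "0 \<le> tight_form (cosine_1 1) (cosine_d 1)"
    by (rule tight_form_nonneg(1)[OF cosine_1_props(1-4) cosine_d_props(1-4)[OF bip]])
  have \<alpha>: "0 < ?\<alpha>" using k0 by simp
  have key: "k * u = nth_eigenvalue G 1 \<and> k * v = nth_eigenvalue G d \<and> tight_form (cosine_1 1) (cosine_d 1) = 0"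
    if u: "k * u \<in> eigenvalues G" "k * u \<noteq> k" and v: "k * v \<in> eigenvalues G" "k * v \<noteq> k"
      and Tuv: "tight_form u v = 0" and pos: "0 < k * u + ?\<alpha>" for u v
  proof -
    have "(k * u + ?\<alpha>) * (k * v + ?\<alpha>) = - M"
      using tight_form_bound[of u v] Tuv by (simp add: M_def)
    then have prod: "(k * u + ?\<alpha>) * (- (k * v + ?\<alpha>)) = M"
      unfolding mult_minus_right by linarith
    then have neg: "0 < - (k * v + ?\<alpha>)" using M pos by (metis zero_less_mult_pos)
    have le: "k * u + ?\<alpha> \<le> nth_eigenvalue G 1 + ?\<alpha>" "- (k * v + ?\<alpha>) \<le> - (nth_eigenvalue G d + ?\<alpha>)"
      using eigenvalue_le_second[OF u] eigenvalue_ge_last[OF v(1)] by simp_all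
    have XY: "(nth_eigenvalue G 1 + ?\<alpha>) * (- (nth_eigenvalue G d + ?\<alpha>)) \<le> (k * u + ?\<alpha>) * (- (k * v + ?\<alpha>))"
      using low prod mult_nonneg_nonneg[OF less_imp_le[OF \<alpha>] T0]
      unfolding mult_minus_right by linarith
    have eq: "nth_eigenvalue G 1 + ?\<alpha> = k * u + ?\<alpha>" "- (nth_eigenvalue G d + ?\<alpha>) = - (k * v + ?\<alpha>)"
      using product_of_nested_intervals[OF pos le(1) neg le(2) XY] by blast+
    then have "?\<alpha> * tight_form (cosine_1 1) (cosine_d 1) = 0"
      using low prod unfolding eq(1) eq(2)[unfolded neg_equal_iff_equal] mult_minus_right by linarith
    then show ?thesis using eq k0 by simp
  qed
  have "k * s + ?\<alpha> \<noteq> 0"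
  proof
    assume "k * s + ?\<alpha> = 0"
    then show False using tight_form_bound[of s r] T k0 b1_pos \<open>a1 \<noteq> 0\<close> by simp
  qed
  then consider "0 < k * s + ?\<alpha>" | "k * s + ?\<alpha> < 0" by linarith
  then have "((k * s = nth_eigenvalue G 1 \<and> k * r = nth_eigenvalue G d) \<or>
         (k * r = nth_eigenvalue G 1 \<and> k * s = nth_eigenvalue G d)) \<and> tight_form (cosine_1 1) (cosine_d 1) = 0"
  proof cases
    case 1
    then show ?thesis using key[OF s(1) ks(1) r(1) ks(2) T] by blast
  next
    case 2
    have "(k * s + ?\<alpha>) * (k * r + ?\<alpha>) = - M"
      using tight_form_bound[of s r] T by (simp add: M_def)
    then have "(- (k * s + ?\<alpha>)) * (k * r + ?\<alpha>) = M"
      unfolding mult_minus_left by linarith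
    then have "0 < k * r + ?\<alpha>" using 2 M by (metis neg_0_less_iff_less zero_less_mult_pos)
    then show ?thesis using key[OF r(1) ks(2) s(1) ks(1)] T tight_form_commute by metis
  qed
  then show "tight_form (cosine_1 1) (cosine_d 1) = 0"
    "(k * s = nth_eigenvalue G 1 \<and> k * r = nth_eigenvalue G d) \<or>
         (k * r = nth_eigenvalue G 1 \<and> k * s = nth_eigenvalue G d)" by blast+
qed

lemma three_term_increments:
  fixes u :: "nat \<Rightarrow> 'a::real_field"
  assumes "three_term \<theta> u" "u 0 = 1" "i \<le> d"
  shows "of_nat (c_num G i) * (u (i - 1) - u i) + of_nat (b_num G i) * (u (Suc i) - u i)
    = of_nat (valency G) * (u 1 - 1) * u i"
proof -
  have "of_nat (valency G) * u i =
     (of_nat (c_num G i) + of_nat (a_num G i) + of_nat (b_num G i)) * u i"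
    using cab_sum[OF assms(3)] by (simp flip: of_nat_add)
  then show ?thesis
    using three_termD[OF assms(1,3)] three_term_0[OF assms(1,2)] by (simp add: algebra_simps)
qed

text \<open>
  The formulas for \<open>b\<^sub>i\<close> and \<open>c\<^sub>i\<close> come from the two recurrences at \<open>i\<close>, the statements about the index \<open>d\<close>
  from those at \<open>d\<close>; the formula for \<open>k\<close> is a rearrangement of the definitions of \<open>\<epsilon>\<close> and \<open>h\<close>.
\<close>

lemma tight_parametrization:
  fixes s r :: "nat \<Rightarrow> real"
  assumes s: "three_term \<theta> s" "s 0 = 1" and r: "three_term \<theta>' r" "r 0 = 1"
    and ne: "s 1 \<noteq> r 1" "s 1 \<noteq> 1" "r 1 \<noteq> 1" "1 + s 1 \<noteq> 0" "1 + r 1 \<noteq> 0"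
    and cross_all: "\<forall>i<d. (s 1 - r 1) * (s (Suc i) * r (Suc i) - s i * r i)
        = (1 - s 1 * r 1) * (s i * r (Suc i) - s (Suc i) * r i)"
    and diff_all: "\<forall>i<d. s i \<noteq> s (Suc i)" "\<forall>i<d. r i \<noteq> r (Suc i)"
    and feas_all: "\<forall>i\<in>{1..d - 1}. s (i - 1) \<noteq> s (i + 1)"
  defines "\<epsilon> \<equiv> (1 - s 1 * r 1) / (s 1 - r 1)" and "h \<equiv> k * (s 1 - r 1) / (1 + s 1)"
  shows "\<epsilon> \<noteq> - 1"
    and "k = h * ((s 1 - \<epsilon>) / (s 1 - 1))"
    and "\<And>i. i \<in> {1..d - 1} \<Longrightarrow> (s (i - 1) - s (i + 1)) * (s (i + 1) - s i) \<noteq> 0 \<and>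
         real (b_num G i) = h * (((s (i - 1) - s 1 * s i) * (s (i + 1) - \<epsilon> * s i)) /
                    ((s (i - 1) - s (i + 1)) * (s (i + 1) - s i)))"
    and "\<And>i. i \<in> {1..d - 1} \<Longrightarrow> (s (i + 1) - s (i - 1)) * (s (i - 1) - s i) \<noteq> 0 \<and>
         real (c_num G i) = h * (((s (i + 1) - s 1 * s i) * (s (i - 1) - \<epsilon> * s i)) /
                    ((s (i + 1) - s (i - 1)) * (s (i - 1) - s i)))"
    and "real (c_num G d) = k" and "s (d - 1) = s 1 * s d"
proof -
  note cross = cross_all[rule_format] and diff = diff_all[rule_format] and feas = feas_all[rule_format]
  have k0: "0 < k" using valency_pos by simp
  have eps: "\<epsilon> * (s 1 - r 1) = 1 - s 1 * r 1" using ne(1) by (simp add: \<epsilon>_def)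
  have h: "h * (1 + s 1) = k * (s 1 - r 1)" using ne(4) by (simp add: h_def)
  have "(\<epsilon> + 1) * (s 1 - r 1) = (1 + s 1) * (1 - r 1)" using eps by (simp add: algebra_simps)
  then show "\<epsilon> \<noteq> - 1" using ne(3,4) by auto
  show "k = h * ((s 1 - \<epsilon>) / (s 1 - 1))"
  proof -
    have "(s 1 - \<epsilon>) * (s 1 - r 1) = (s 1 - 1) * (1 + s 1)" using eps by (simp add: algebra_simps)
    moreover define X where "X = (s 1 - \<epsilon>) / (s 1 - 1)"
    moreover have "s 1 - \<epsilon> = X * (s 1 - 1)" using ne(2) by (simp add: X_def)
    ultimately have "(s 1 - 1) * (X * (s 1 - r 1)) = (s 1 - 1) * (1 + s 1)"
      by (simp add: mult_ac)
    then have "X * (s 1 - r 1) = 1 + s 1" using ne(2) by simp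
    then have "(1 + s 1) * k = X * (s 1 - r 1) * k" by simp
    also have "\<dots> = X * (k * (s 1 - r 1))" by (simp only: mult_ac)
    also have "\<dots> = (1 + s 1) * (h * X)" unfolding h[symmetric] by simp
    finally have "k = h * X" using mult_left_cancel[OF ne(4)] by blast
    then show ?thesis by (simp only: X_def)
  qed
  {
    fix i assume i: "i \<in> {1..d - 1}"
    then obtain j where j: "i = Suc j" "i < d" "j < d" using diam_ge_2 by (cases i) auto
    have nz: "\<not> (s j = 0 \<and> s i = 0)" "\<not> (s i = 0 \<and> s (Suc i) = 0)"
        "\<not> (r j = 0 \<and> r i = 0)" "\<not> (r i = 0 \<and> r (Suc i) = 0)"
      using three_term_consecutive_zeros[OF s] three_term_consecutive_zeros[OF r] j by blast+
    have rec: "c_num G i * (s j - s i) + b_num G i * (s (Suc i) - s i) = k * (s 1 - 1) * s i"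
      using three_term_increments[OF s, of i] j by simp
    have rec': "c_num G i * (r j - r i) + b_num G i * (r (Suc i) - r i) = k * (r 1 - 1) * r i"
      using three_term_increments[OF r, of i] j by simp
    have pw: "s j \<noteq> s (Suc i)" using feas[OF i] j(1) by simp
    have cr: "(s 1 - r 1) * (s i * r i - s j * r j) = (1 - s 1 * r 1) * (s j * r i - s i * r j)"
      "(s 1 - r 1) * (s (Suc i) * r (Suc i) - s i * r i) = (1 - s 1 * r 1) * (s i * r (Suc i) - s (Suc i) * r i)"
      using cross[OF j(3)] cross[OF j(2)] unfolding j(1) .
    have B: "b_num G i * ((s j - s (Suc i)) * (s (Suc i) - s i)) = h * ((s j - s 1 * s i) * (s (Suc i) - \<epsilon> * s i))"
      by (rule solve_two_recurrences[OF eps h ne cr rec rec' nz pw])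
    \<comment> \<open>Exchanging the neighbours \<open>i - 1\<close> and \<open>i + 1\<close> of the index \<open>i\<close> exchanges \<open>b\<^sub>i\<close> and \<open>c\<^sub>i\<close>.\<close>
    have cr': "(s 1 - r 1) * (s i * r i - s (Suc i) * r (Suc i)) = (1 - s 1 * r 1) * (s (Suc i) * r i - s i * r (Suc i))"
      "(s 1 - r 1) * (s j * r j - s i * r i) = (1 - s 1 * r 1) * (s i * r j - s j * r i)"
      using cr by (simp_all add: algebra_simps)
    have rec_sw: "b_num G i * (s (Suc i) - s i) + c_num G i * (s j - s i) = k * (s 1 - 1) * s i"
      "b_num G i * (r (Suc i) - r i) + c_num G i * (r j - r i) = k * (r 1 - 1) * r i"
      using rec rec' by simp_all
    have nz_sw: "\<not> (s (Suc i) = 0 \<and> s i = 0)" "\<not> (s i = 0 \<and> s j = 0)"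
      "\<not> (r (Suc i) = 0 \<and> r i = 0)" "\<not> (r i = 0 \<and> r j = 0)"
      using nz by blast+
    have C: "c_num G i * ((s (Suc i) - s j) * (s j - s i)) = h * ((s (Suc i) - s 1 * s i) * (s j - \<epsilon> * s i))"
      by (rule solve_two_recurrences[OF eps h ne cr' rec_sw nz_sw pw[symmetric]])
    have d1: "(s j - s (Suc i)) * (s (Suc i) - s i) \<noteq> 0" using pw diff(1)[OF j(2)] by simp
    have d2: "(s (Suc i) - s j) * (s j - s i) \<noteq> 0" using pw diff(1)[OF j(3)] j(1) by simp
    show "(s (i - 1) - s (i + 1)) * (s (i + 1) - s i) \<noteq> 0 \<and>
         real (b_num G i) = h * (((s (i - 1) - s 1 * s i) * (s (i + 1) - \<epsilon> * s i)) /
                    ((s (i - 1) - s (i + 1)) * (s (i + 1) - s i)))"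
      using d1 eq_divide_imp[OF d1 B] j(1) by simp
    show "(s (i + 1) - s (i - 1)) * (s (i - 1) - s i) \<noteq> 0 \<and>
         real (c_num G i) = h * (((s (i + 1) - s 1 * s i) * (s (i - 1) - \<epsilon> * s i)) /
                    ((s (i + 1) - s (i - 1)) * (s (i - 1) - s i)))"
      using d2 eq_divide_imp[OF d2 C] j(1) by simp
  }
  obtain e where e: "d = Suc e" using diam_ge_2 by (cases d) auto
  have rec: "c_num G d * (s e - s d) = k * (s 1 - 1) * s d"
    using three_term_increments[OF s order_refl] unfolding b_d by (simp add: e)
  have rec': "c_num G d * (r e - r d) = k * (r 1 - 1) * r d"
    using three_term_increments[OF r order_refl] unfolding b_d by (simp add: e)
  have sd: "s e \<noteq> s d" "r e \<noteq> r d" using diff[of e] e by simp_all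
  have kne: "k \<noteq> 0" using k0 by simp
  have cr: "(s 1 - r 1) * (s d * r d - s e * r e) = (1 - s 1 * r 1) * (s e * r d - s d * r e)"
    using cross[of e] e by simp
  have "real (c_num G d) = k \<and> s e = s 1 * s d"
    using solve_last_recurrences[OF ne(1) sd kne cr rec rec'] by blast
  then show "real (c_num G d) = k" "s (d - 1) = s 1 * s d" by (simp_all add: e)
qed

end

section \<open>The two cosine sequences of a parametrization\<close>

text \<open>
  The converse of \<open>solve_two_recurrences\<close>: if \<open>B\<close> and \<open>C\<close> are given by the formulas and \<open>p', q', w'\<close> are
  linked to \<open>p, q, w\<close> by the cross relation, then the second recurrence holds.
\<close>

lemma ratio_step_recurrence:
  fixes h k s r \<epsilon> B C p q w p' q' w' :: "'a::field"
  assumes k: "k * (s - 1) = h * (s - \<epsilon>)" and r: "r * (s - \<epsilon>) = 1 - \<epsilon> * s" and ne: "s - \<epsilon> \<noteq> 0" "s \<noteq> 1"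
    and pw: "p \<noteq> w"
    and B: "B * ((p - w) * (w - q)) = h * ((p - s * q) * (w - \<epsilon> * q))"
    and C: "C * ((w - p) * (p - q)) = h * ((w - s * q) * (p - \<epsilon> * q))"
    and P: "p - \<epsilon> * q \<noteq> 0" "p' * (p - \<epsilon> * q) = q' * (q - \<epsilon> * p)"
    and W: "w - \<epsilon> * q \<noteq> 0" "w' * (w - \<epsilon> * q) = q' * (q - \<epsilon> * w)"
  shows "C * (p' - q') + B * (w' - q') = k * (r - 1) * q'"
proof -
  have *: "(p' - q') * (p - \<epsilon> * q) = q' * (1 + \<epsilon>) * (q - p)"
    using P(2) by (simp add: algebra_simps)
  have "(p - \<epsilon> * q) * (C * (p' - q') * (w - p)) = C * (w - p) * ((p' - q') * (p - \<epsilon> * q))"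
    by (simp only: mult_ac)
  also have "\<dots> = - (C * ((w - p) * (p - q))) * (q' * (1 + \<epsilon>))"
    unfolding * by (simp add: algebra_simps) 
  also have "\<dots> = (p - \<epsilon> * q) * (- h * (w - s * q) * q' * (1 + \<epsilon>))"
    unfolding C by (simp add: mult_ac)
  finally have 1: "C * (p' - q') * (w - p) = - h * (w - s * q) * q' * (1 + \<epsilon>)"
    using mult_left_cancel[OF P(1)] by blast
  have *: "(w' - q') * (w - \<epsilon> * q) = q' * (1 + \<epsilon>) * (q - w)"
    using W(2) by (simp add: algebra_simps)
  have "(w - \<epsilon> * q) * (B * (w' - q') * (p - w)) = B * (p - w) * ((w' - q') * (w - \<epsilon> * q))"
    by (simp only: mult_ac)
  also have "\<dots> = - (B * ((p - w) * (w - q))) * (q' * (1 + \<epsilon>))"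
    unfolding * by (simp add: algebra_simps)
  also have "\<dots> = (w - \<epsilon> * q) * (- h * (p - s * q) * q' * (1 + \<epsilon>))"
    unfolding B by (simp add: mult_ac)
  finally have 2: "B * (w' - q') * (p - w) = - h * (p - s * q) * q' * (1 + \<epsilon>)"
    using mult_left_cancel[OF W(1)] by blast
  have "(w - p) * (C * (p' - q') + B * (w' - q')) = C * (p' - q') * (w - p) - B * (w' - q') * (p - w)"
    by (simp add: algebra_simps)
  also have "\<dots> = (w - p) * (- h * (1 + \<epsilon>) * q')"
    unfolding 1 2 by (simp add: algebra_simps)
  finally have 3: "C * (p' - q') + B * (w' - q') = - h * (1 + \<epsilon>) * q'"
    using mult_left_cancel[of "w - p"] pw by (metis eq_iff_diff_eq_0)
  have "(s - 1) * ((s - \<epsilon>) * (k * (r - 1))) = (k * (s - 1)) * (r * (s - \<epsilon>) - (s - \<epsilon>))"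
    by (simp add: algebra_simps)
  also have "\<dots> = (s - 1) * ((s - \<epsilon>) * (- h * (1 + \<epsilon>)))"
    unfolding k r by (simp add: algebra_simps)
  finally have "((s - 1) * (s - \<epsilon>)) * (k * (r - 1)) = ((s - 1) * (s - \<epsilon>)) * (- h * (1 + \<epsilon>))"
    by (simp only: mult.assoc)
  moreover have "(s - 1) * (s - \<epsilon>) \<noteq> 0" using ne by simp
  ultimately have "k * (r - 1) = - h * (1 + \<epsilon>)" using mult_left_cancel by blast
  then show ?thesis unfolding 3 by simp
qed

context drg begin

text \<open>
  The columns of the profile matrix are eigenvectors of a real symmetric matrix, so \<open>\<theta>\<close> is real. The
  imaginary parts then satisfy a real recurrence and start with 0.
\<close>

lemma three_term_complex_real:
  fixes u :: "nat \<Rightarrow> complex"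
  assumes u: "three_term \<theta> u" "u 0 = 1"
  shows "Im \<theta> = 0" "\<And>i. i \<le> d \<Longrightarrow> Im (u i) = 0" "three_term (Re \<theta>) (\<lambda>i. Re (u i))"
proof -
  let ?A = "adjacency_matrix G"
  define y :: 'v where "y = undefined"
  define v w :: "real^'v" where "v = (\<chi> x. Re (u (D x y)))" and "w = (\<chi> x. Im (u (D x y)))"
  have eq: "(\<Sum>z | D x z = 1. u (D z y)) = \<theta> * u (D x y)" for x
    by (rule adjacency_profile[OF u(1)])
  have Av: "?A *v v = Re \<theta> *\<^sub>R v - Im \<theta> *\<^sub>R w"
    using arg_cong[OF eq, of Re] by (simp add: vec_eq_iff adjacency_mult v_def w_def del: One_nat_def)
  have Aw: "?A *v w = Im \<theta> *\<^sub>R v + Re \<theta> *\<^sub>R w"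
    using arg_cong[OF eq, of Im]
    by (simp add: vec_eq_iff adjacency_mult v_def w_def add.commute del: One_nat_def)
  have "(?A *v v) \<bullet> w = v \<bullet> (?A *v w)" by (rule symmetric_matrix_inner[OF adjacency_symmetric])
  then have "Im \<theta> * (v \<bullet> v + w \<bullet> w) = 0"
    unfolding Av Aw by (simp add: inner_diff_left inner_add_right algebra_simps)
  moreover have "v \<noteq> 0"
  proof
    assume "v = 0"
    then have "v $ y = 0" by simp
    then show False by (simp add: v_def u(2))
  qed
  then have "0 < v \<bullet> v + w \<bullet> w" by (simp add: add_pos_nonneg)
  ultimately show Im: "Im \<theta> = 0" by simp
  have rec: "c_num G i * Im (u (i - 1)) + a_num G i * Im (u i) + b_num G i * Im (u (Suc i)) = Re \<theta> * Im (u i)"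
    if "i \<le> d" for i
    using arg_cong[OF three_termD[OF u(1) that], of Im] Im by simp
  show "Im (u i) = 0" if "i \<le> d" for i
    using that
  proof (induction i rule: less_induct)
    case (less i)
    show ?case
    proof (cases i)
      case (Suc j)
      then have "Im (u j) = 0" "Im (u (j - 1)) = 0" using less by auto
      then have "b_num G j * Im (u (Suc j)) = 0" using rec[of j] less.prems Suc by simp
      then show ?thesis using b_pos[of j] less.prems Suc by simp
    qed (simp add: u(2))
  qed
  show "three_term (Re \<theta>) (\<lambda>i. Re (u i))"
    unfolding three_term_def
  proof (intro allI impI)
    fix i assume "i \<le> d"
    then show "of_nat (c_num G i) * Re (u (i - 1)) + of_nat (a_num G i) * Re (u i)
        + of_nat (b_num G i) * Re (u (Suc i)) = Re \<theta> * Re (u i)"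
      using arg_cong[OF three_termD[OF u(1)], of i Re] Im by simp
  qed
qed

text \<open>
  Eliminating \<open>a\<^sub>i = k - b\<^sub>i - c\<^sub>i\<close> states the recurrence in terms of the given parameters only.
\<close>

lemma three_termI_increments:
  fixes u :: "nat \<Rightarrow> 'a::real_field"
  assumes "\<And>i. i \<le> d \<Longrightarrow> of_nat (c_num G i) * (u (i - 1) - u i) + of_nat (b_num G i) * (u (Suc i) - u i)
    = of_nat (valency G) * (u 1 - 1) * u i"
  shows "three_term (of_nat (valency G) * u 1) u"
  unfolding three_term_def
proof (intro allI impI)
  fix i assume i: "i \<le> d"
  have "of_nat (valency G) * u i =
     (of_nat (c_num G i) + of_nat (a_num G i) + of_nat (b_num G i)) * u i"
    using cab_sum[OF i] by (simp flip: of_nat_add)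
  then show "of_nat (c_num G i) * u (i - 1) + of_nat (a_num G i) * u i
      + of_nat (b_num G i) * u (Suc i) = of_nat (valency G) * u 1 * u i"
    using assms[OF i] by (simp add: algebra_simps)
qed

lemma b_0: "b_num G 0 = valency G"
  by (simp add: valency_def)

text \<open>
  The formulas for \<open>b\<^sub>i\<close> and \<open>c\<^sub>i\<close> imply the recurrence of \<open>\<sigma>\<close> by a direct computation. The second
  sequence is the one that the cross relation prescribes, started with \<open>\<rho> 0 = 1\<close>.
\<close>

lemma parameters_sequences:
  fixes \<sigma> :: "nat \<Rightarrow> complex" and \<epsilon> h K :: complex
  assumes K: "K = of_nat (valency G)"
    and s0: "\<sigma> 0 = 1" and last: "\<sigma> (d - 1) = \<sigma> 1 * \<sigma> d" and s1: "\<sigma> 1 - 1 \<noteq> 0"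
    and k: "K = h * ((\<sigma> 1 - \<epsilon>) / (\<sigma> 1 - 1))"
    and b: "\<And>i. i \<in> {1..d - 1} \<Longrightarrow> (\<sigma> (i - 1) - \<sigma> (i + 1)) * (\<sigma> (i + 1) - \<sigma> i) \<noteq> 0 \<and>
         of_nat (b_num G i) = h * (((\<sigma> (i - 1) - \<sigma> 1 * \<sigma> i) * (\<sigma> (i + 1) - \<epsilon> * \<sigma> i)) /
                    ((\<sigma> (i - 1) - \<sigma> (i + 1)) * (\<sigma> (i + 1) - \<sigma> i)))"
    and c: "\<And>i. i \<in> {1..d - 1} \<Longrightarrow> (\<sigma> (i + 1) - \<sigma> (i - 1)) * (\<sigma> (i - 1) - \<sigma> i) \<noteq> 0 \<and>
         of_nat (c_num G i) = h * (((\<sigma> (i + 1) - \<sigma> 1 * \<sigma> i) * (\<sigma> (i - 1) - \<epsilon> * \<sigma> i)) /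
                    ((\<sigma> (i + 1) - \<sigma> (i - 1)) * (\<sigma> (i - 1) - \<sigma> i)))"
    and cd: "of_nat (c_num G d) = K"
  obtains \<rho> where "three_term (K * \<sigma> 1) \<sigma>" "three_term (K * \<rho> 1) \<rho>" "\<rho> 0 = 1"
    "\<rho> 1 * (\<sigma> 1 - \<epsilon>) = 1 - \<epsilon> * \<sigma> 1"
    "\<And>i. i < d \<Longrightarrow> \<rho> (Suc i) * (\<sigma> (Suc i) - \<epsilon> * \<sigma> i) = \<rho> i * (\<sigma> i - \<epsilon> * \<sigma> (Suc i))"
proof -
  have K0: "K \<noteq> 0" using valency_pos by (simp add: K)
  then have se: "\<sigma> 1 - \<epsilon> \<noteq> 0" using k by auto
  have k': "K * (\<sigma> 1 - 1) = h * (\<sigma> 1 - \<epsilon>)" using k s1 by simp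
  have B: "of_nat (b_num G i) * ((\<sigma> (i - 1) - \<sigma> (i + 1)) * (\<sigma> (i + 1) - \<sigma> i))
      = h * ((\<sigma> (i - 1) - \<sigma> 1 * \<sigma> i) * (\<sigma> (i + 1) - \<epsilon> * \<sigma> i))" if "i \<in> {1..d - 1}" for i
    using b[OF that] by (metis (no_types, lifting) nonzero_eq_divide_eq times_divide_eq_right)
  have C: "of_nat (c_num G i) * ((\<sigma> (i + 1) - \<sigma> (i - 1)) * (\<sigma> (i - 1) - \<sigma> i))
      = h * ((\<sigma> (i + 1) - \<sigma> 1 * \<sigma> i) * (\<sigma> (i - 1) - \<epsilon> * \<sigma> i))" if "i \<in> {1..d - 1}" for i
    using c[OF that] by (metis (no_types, lifting) nonzero_eq_divide_eq times_divide_eq_right)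
  have W: "\<sigma> (i + 1) - \<epsilon> * \<sigma> i \<noteq> 0" if "i \<in> {1..d - 1}" for i
  proof -
    have "i < d" using that diam_ge_2 by auto
    then show ?thesis using b[OF that] b_pos[of i] by auto
  qed
  have P: "\<sigma> (i - 1) - \<epsilon> * \<sigma> i \<noteq> 0" if "i \<in> {1..d - 1}" for i
  proof -
    have "0 < i" "i \<le> d" using that by auto
    then show ?thesis using c[OF that] c_pos[of i] by auto
  qed
  have den: "\<sigma> (Suc i) - \<epsilon> * \<sigma> i \<noteq> 0" if "i < d" for i
    using W[of i] se s0 that by (cases i) auto
  have three_\<sigma>: "three_term (of_nat (valency G) * \<sigma> 1) \<sigma>"
  proof (rule three_termI_increments)
    fix i assume "i \<le> d"
    then consider "i = 0" | "i \<in> {1..d - 1}" | "i = d" by force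
    then show "of_nat (c_num G i) * (\<sigma> (i - 1) - \<sigma> i) + of_nat (b_num G i) * (\<sigma> (Suc i) - \<sigma> i)
        = of_nat (valency G) * (\<sigma> 1 - 1) * \<sigma> i"
    proof cases
      case 1
      then show ?thesis by (simp add: s0 b_0)
    next
      case 2
      let ?p = "\<sigma> (i - 1)" and ?q = "\<sigma> i" and ?w = "\<sigma> (i + 1)"
      have d1: "?p - ?w \<noteq> 0" "?w - ?q \<noteq> 0" "?p - ?q \<noteq> 0" using b[OF 2] c[OF 2] by auto
      have "(?p - ?w) * (of_nat (c_num G i) * (?p - ?q) + of_nat (b_num G i) * (?w - ?q))
          = of_nat (b_num G i) * ((?p - ?w) * (?w - ?q)) - of_nat (c_num G i) * ((?w - ?p) * (?p - ?q))"
        by (simp add: algebra_simps)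
      also have "\<dots> = (?p - ?w) * (h * (\<sigma> 1 - \<epsilon>) * ?q)"
        unfolding B[OF 2] C[OF 2] by (simp add: algebra_simps)
      finally show ?thesis using d1(1) unfolding K[symmetric] k' by simp
    next
      case 3
      then show ?thesis using cd last by (simp add: K algebra_simps)
    qed
  qed
  \<comment> \<open>The denominators are nonzero because \<open>b\<^sub>j\<close> and \<open>k\<close> are.\<close>
  define \<rho> where "\<rho> i = (\<Prod>j<i. (\<sigma> j - \<epsilon> * \<sigma> (Suc j)) / (\<sigma> (Suc j) - \<epsilon> * \<sigma> j))" for i
  have rel: "\<rho> (Suc i) * (\<sigma> (Suc i) - \<epsilon> * \<sigma> i) = \<rho> i * (\<sigma> i - \<epsilon> * \<sigma> (Suc i))" if "i < d" for i
    using den[OF that] by (simp add: \<rho>_def)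
  have \<rho>0: "\<rho> 0 = 1" by (simp add: \<rho>_def)
  have \<rho>1: "\<rho> 1 * (\<sigma> 1 - \<epsilon>) = 1 - \<epsilon> * \<sigma> 1"
    using rel[of 0] diam_ge_2 by (simp add: s0 \<rho>0)
  have three_\<rho>: "three_term (of_nat (valency G) * \<rho> 1) \<rho>"
  proof (rule three_termI_increments)
    fix i assume "i \<le> d"
    then consider "i = 0" | "i \<in> {1..d - 1}" | "i = d" by force
    then show "of_nat (c_num G i) * (\<rho> (i - 1) - \<rho> i) + of_nat (b_num G i) * (\<rho> (Suc i) - \<rho> i)
        = of_nat (valency G) * (\<rho> 1 - 1) * \<rho> i"
    proof cases
      case 1
      then show ?thesis by (simp add: \<rho>0 b_0)
    next
      case 2
      then obtain j where j: "i = Suc j" "j < d" "i < d" by (cases i) auto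
      show ?thesis
        unfolding K[symmetric]
      proof (rule ratio_step_recurrence[OF k' \<rho>1 se, where w = "\<sigma> (i + 1)" and q = "\<sigma> i" and p = "\<sigma> (i - 1)"])
        show "\<rho> (i - 1) * (\<sigma> (i - 1) - \<epsilon> * \<sigma> i) = \<rho> i * (\<sigma> i - \<epsilon> * \<sigma> (i - 1))"
          using rel[OF j(2)] j(1) by simp
        show "\<rho> (Suc i) * (\<sigma> (i + 1) - \<epsilon> * \<sigma> i) = \<rho> i * (\<sigma> i - \<epsilon> * \<sigma> (i + 1))"
          using rel[OF j(3)] by simp
      qed (use s1 b[OF 2] c[OF 2] B[OF 2] C[OF 2] P[OF 2] W[OF 2] in auto)
    next
      case 3
      obtain e where e: "d = Suc e" "e < d" using diam_ge_2 by (cases d) auto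
      have "\<sigma> d \<noteq> 0"
      proof
        assume "\<sigma> d = 0"
        then have "\<sigma> e = 0" "\<sigma> (Suc e) = 0" using last e by simp_all
        then show False using three_term_consecutive_zeros[OF three_\<sigma> s0 e(2)] by simp
      qed
      have "\<rho> d * (\<sigma> d - \<epsilon> * (\<sigma> 1 * \<sigma> d)) = \<rho> e * (\<sigma> 1 * \<sigma> d - \<epsilon> * \<sigma> d)"
        using rel[OF e(2)] last e by simp
      then have "\<sigma> d * (\<rho> d * (1 - \<epsilon> * \<sigma> 1)) = \<sigma> d * (\<rho> e * (\<sigma> 1 - \<epsilon>))"
        by (simp add: algebra_simps)
      then have "\<rho> d * (\<rho> 1 * (\<sigma> 1 - \<epsilon>)) = \<rho> e * (\<sigma> 1 - \<epsilon>)"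
        using \<open>\<sigma> d \<noteq> 0\<close> \<rho>1 by simp
      then have "(\<rho> d * \<rho> 1) * (\<sigma> 1 - \<epsilon>) = \<rho> e * (\<sigma> 1 - \<epsilon>)" by (simp only: mult.assoc)
      then have "\<rho> e = \<rho> d * \<rho> 1" using se mult_right_cancel by metis
      then show ?thesis using cd e unfolding 3 b_d by (simp add: K algebra_simps)
    qed
  qed
  show ?thesis
    by (rule that[of \<rho>]) (use three_\<sigma> three_\<rho> \<rho>0 \<rho>1 rel in \<open>simp_all add: K\<close>)
qed

end

section \<open>The characterization of tight graphs\<close>

lemma scale_from_first_equation:
  fixes h s w e :: "'a::field"
  assumes "1 = h * (((w - s * s) * (1 - e * s)) / ((w - 1) * (1 - s)))"
  shows "h = ((1 - s) * (1 - w)) / ((s\<^sup>2 - w) * (1 - e * s))"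
proof -
  have ne: "(w - s * s) * (1 - e * s) \<noteq> 0" "(w - 1) * (1 - s) \<noteq> 0" using assms by auto
  then have "h * ((w - s * s) * (1 - e * s)) = (w - 1) * (1 - s)" using assms by (simp add: field_simps)
  then have "h * ((s\<^sup>2 - w) * (1 - e * s)) = (1 - s) * (1 - w)"
    by (simp add: power2_eq_square algebra_simps)
  moreover have "(s\<^sup>2 - w) * (1 - e * s) \<noteq> 0" using ne(1) by (auto simp: power2_eq_square)
  ultimately show ?thesis by (simp add: eq_divide_eq)
qed

context drg begin

lemma auxiliary_parameter_cosines:
  fixes s r :: real
  assumes "\<theta> = k * s" "complementary_eigenvalue G \<theta> = k * r"
  shows "auxiliary_parameter G \<theta> = (1 - s * r) / (s - r)"
proof -
  have k0: "k \<noteq> 0" using valency_pos by simp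
  have "k\<^sup>2 - k * s * (k * r) = k\<^sup>2 * (1 - s * r)" "k * (k * s - k * r) = k\<^sup>2 * (s - r)"
    by (simp_all add: power2_eq_square algebra_simps)
  then show ?thesis unfolding auxiliary_parameter_def Let_def assms(2) unfolding assms(1)
    using k0 by simp
qed

definition parametrized :: "(nat \<Rightarrow> complex) \<Rightarrow> complex \<Rightarrow> complex \<Rightarrow> bool" where
  "parametrized \<sigma> \<epsilon> h \<longleftrightarrow>
     (\<sigma> 0 = 1 \<and> \<sigma> (d - 1) = \<sigma> 1 * \<sigma> d \<and> \<epsilon> \<noteq> - 1 \<and>
      \<sigma> 1 - 1 \<noteq> 0 \<and>
      of_nat (valency G) = h * ((\<sigma> 1 - \<epsilon>) / (\<sigma> 1 - 1)) \<and>
      (\<forall>i\<in>{1..d - 1}.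
         (\<sigma> (i - 1) - \<sigma> (i + 1)) * (\<sigma> (i + 1) - \<sigma> i) \<noteq> 0 \<and>
         of_nat (b_num G i) = h * (((\<sigma> (i - 1) - \<sigma> 1 * \<sigma> i) * (\<sigma> (i + 1) - \<epsilon> * \<sigma> i)) /
                    ((\<sigma> (i - 1) - \<sigma> (i + 1)) * (\<sigma> (i + 1) - \<sigma> i)))) \<and>
      (\<forall>i\<in>{1..d - 1}.
         (\<sigma> (i + 1) - \<sigma> (i - 1)) * (\<sigma> (i - 1) - \<sigma> i) \<noteq> 0 \<and>
         of_nat (c_num G i) = h * (((\<sigma> (i + 1) - \<sigma> 1 * \<sigma> i) * (\<sigma> (i - 1) - \<epsilon> * \<sigma> i)) /
                    ((\<sigma> (i + 1) - \<sigma> (i - 1)) * (\<sigma> (i - 1) - \<sigma> i)))) \<and>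
      of_nat (c_num G d) = h * ((\<sigma> 1 - \<epsilon>) / (\<sigma> 1 - 1)))"

lemma parametrized_scale:
  assumes "parametrized \<sigma> \<epsilon> h"
  shows "h = ((1 - \<sigma> 1) * (1 - \<sigma> 2)) / (((\<sigma> 1)\<^sup>2 - \<sigma> 2) * (1 - \<epsilon> * \<sigma> 1))"
proof (rule scale_from_first_equation)
  have "1 \<in> {1..d - 1}" using diam_ge_2 by simp
  then have "of_nat (c_num G 1) = h * (((\<sigma> (1 + 1) - \<sigma> 1 * \<sigma> 1) * (\<sigma> (1 - 1) - \<epsilon> * \<sigma> 1)) /
                    ((\<sigma> (1 + 1) - \<sigma> (1 - 1)) * (\<sigma> (1 - 1) - \<sigma> 1)))"
    using assms unfolding parametrized_def by blast
  moreover have "\<sigma> 0 = 1" using assms unfolding parametrized_def by blast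
  ultimately show "1 = h * (((\<sigma> 2 - \<sigma> 1 * \<sigma> 1) * (1 - \<epsilon> * \<sigma> 1)) / ((\<sigma> 2 - 1) * (1 - \<sigma> 1)))"
    unfolding c_1 one_add_one diff_self_eq_0 by simp
qed

text \<open>
  The eigenvalue of the given sequence is one of the two extreme ones; the other extreme eigenvalue
  supplies the second sequence. The cross relation is symmetric in the two, so both cases end in the
  same computation.
\<close>

lemma tight_imp_parametrized:
  assumes "tight G" and feas: "feasible_cosine_sequence G \<theta> s"
    and \<sigma>: "\<And>i. i \<le> d \<Longrightarrow> \<sigma> i = complex_of_real (s i)"
    and \<epsilon>: "\<epsilon> = complex_of_real (auxiliary_parameter G \<theta>)"
  obtains h where "parametrized \<sigma> \<epsilon> h"
proof -
  have bip: "\<not> drg_bipartite G" and T: "tight_form (cosine_1 1) (cosine_d 1) = 0"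
    using \<open>tight G\<close> unfolding tight_iff_form by blast+
  have cs: "cosine_sequence G \<theta> s" and \<theta>: "\<theta> \<in> {nth_eigenvalue G 1, nth_eigenvalue G d}"
    and f: "\<forall>i\<in>{1..d - 1}. s (i - 1) \<noteq> s (i + 1)"
    using feas unfolding feasible_cosine_sequence_def by blast+
  note s = cosine_sequence_three_term[OF cs]
  have \<theta>s: "\<theta> = k * s 1" by (rule three_term_0[OF s])
  have k0: "0 < k" using valency_pos by simp
  note one = cosine_1_props and last = cosine_d_props[OF bip]
  have lt: "cosine_d 1 < cosine_1 1"
  proof -
    have "k * cosine_d 1 < k * cosine_1 1" using one(4) last(4) by linarith
    then show ?thesis using mult_less_cancel_left_pos[OF k0] by blast
  qed
  have ends: "nth_eigenvalue G d \<noteq> nth_eigenvalue G 1" using nth_eigenvalue_ends(1) by simp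
  obtain \<theta>' r where r: "three_term \<theta>' r" "r 0 = 1" and comp: "complementary_eigenvalue G \<theta> = k * r 1"
    and ne: "s 1 \<noteq> r 1" "s 1 \<noteq> 1" "r 1 \<noteq> 1" "1 + s 1 \<noteq> 0" "1 + r 1 \<noteq> 0"
    and cross: "\<forall>i<d. (s 1 - r 1) * (s (Suc i) * r (Suc i) - s i * r i)
        = (1 - s 1 * r 1) * (s i * r (Suc i) - s (Suc i) * r i)"
    and diff: "\<forall>i<d. s i \<noteq> s (Suc i)" "\<forall>i<d. r i \<noteq> r (Suc i)"
  proof (cases "\<theta> = nth_eigenvalue G 1")
    case True
    then have s1: "s 1 = cosine_1 1" using \<theta>s one(5) k0 by simp
    have rel: "(s 1 - cosine_d 1) * (s (Suc i) * cosine_d (Suc i) - s i * cosine_d i)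
        = (1 - s 1 * cosine_d 1) * (s i * cosine_d (Suc i) - s (Suc i) * cosine_d i)"
      "s i \<noteq> s (Suc i)" "cosine_d i \<noteq> cosine_d (Suc i)" if "i < d" for i
      using tight_cosine_relation[OF s one(3)[folded s1] one(4)[folded s1] last(1-4) T[folded s1] that]
      by blast+
    show ?thesis
    proof (rule that[OF last(1,2)])
      show "complementary_eigenvalue G \<theta> = k * cosine_d 1"
        using True last(5) by (simp add: complementary_eigenvalue_def)
    qed (use rel s1 lt one(3) last(3) in auto)
  next
    case False
    then have \<theta>d: "\<theta> = nth_eigenvalue G d" using \<theta> by blast
    then have s1: "s 1 = cosine_d 1" using \<theta>s last(5) k0 by simp
    have rel: "(cosine_1 1 - s 1) * (cosine_1 (Suc i) * s (Suc i) - cosine_1 i * s i)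
        = (1 - cosine_1 1 * s 1) * (cosine_1 i * s (Suc i) - cosine_1 (Suc i) * s i)"
      and diffs: "cosine_1 i \<noteq> cosine_1 (Suc i)" "s i \<noteq> s (Suc i)" if "i < d" for i
      using tight_cosine_relation[OF one(1-4) s last(3)[folded s1] last(4)[folded s1] T[folded s1] that]
      by blast+
    show ?thesis
    proof (rule that[OF one(1,2)])
      show "complementary_eigenvalue G \<theta> = k * cosine_1 1"
        using False one(5) by (simp add: complementary_eigenvalue_def)
      have "(s 1 - cosine_1 1) * (s (Suc i) * cosine_1 (Suc i) - s i * cosine_1 i)
        = (1 - s 1 * cosine_1 1) * (s i * cosine_1 (Suc i) - s (Suc i) * cosine_1 i)" if "i < d" for i
        using rel[OF that] by (simp add: algebra_simps)
      then show "\<forall>i<d. (s 1 - cosine_1 1) * (s (Suc i) * cosine_1 (Suc i) - s i * cosine_1 i)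
        = (1 - s 1 * cosine_1 1) * (s i * cosine_1 (Suc i) - s (Suc i) * cosine_1 i)" by blast
    qed (use diffs s1 lt one(3) last(3) in auto)
  qed
  define E where "E = (1 - s 1 * r 1) / (s 1 - r 1)"
  define H where "H = k * (s 1 - r 1) / (1 + s 1)"
  note par = tight_parametrization[OF s r ne cross diff f, folded E_def H_def]
  have \<epsilon>E: "\<epsilon> = complex_of_real E"
    unfolding \<epsilon> E_def auxiliary_parameter_cosines[OF \<theta>s comp] ..
  have sig: "\<sigma> 0 = complex_of_real (s 0)" "\<sigma> 1 = complex_of_real (s 1)" "\<sigma> d = complex_of_real (s d)"
    "\<sigma> (d - 1) = complex_of_real (s (d - 1))"
    using \<sigma> diam_ge_2 by simp_all
  have sigi: "\<sigma> i = complex_of_real (s i)" "\<sigma> (i - 1) = complex_of_real (s (i - 1))"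
    "\<sigma> (i + 1) = complex_of_real (s (i + 1))" if "i \<in> {1..d - 1}" for i
    using \<sigma>[of i] \<sigma>[of "i - 1"] \<sigma>[of "i + 1"] that by auto
  have cast: "of_nat n = complex_of_real (real n)" for n by simp
  have "parametrized \<sigma> \<epsilon> (complex_of_real H)"
    unfolding parametrized_def
  proof (intro conjI ballI)
    show "\<sigma> 0 = 1" "\<sigma> (d - 1) = \<sigma> 1 * \<sigma> d" using sig s(2) par(6) by simp_all
    show "\<epsilon> \<noteq> - 1"
    proof
      assume "\<epsilon> = - 1"
      then have "complex_of_real E = complex_of_real (- 1)" by (simp add: \<epsilon>E)
      then have "E = - 1" unfolding of_real_eq_iff .
      then show False using par(1) by blast
    qed
    show "\<sigma> 1 - 1 \<noteq> 0" using ne(2) sig(2) by simp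
    have kk: "complex_of_real k = complex_of_real (H * ((s 1 - E) / (s 1 - 1)))"
      using par(2) by simp
    then show "of_nat (valency G) = complex_of_real H * ((\<sigma> 1 - \<epsilon>) / (\<sigma> 1 - 1))"
      unfolding cast sig \<epsilon>E by simp
    have "c_num G d = valency G" using par(5) by simp
    then show "of_nat (c_num G d) = complex_of_real H * ((\<sigma> 1 - \<epsilon>) / (\<sigma> 1 - 1))"
      using kk unfolding sig \<epsilon>E by simp
    fix i assume i: "i \<in> {1..d - 1}"
    show "(\<sigma> (i - 1) - \<sigma> (i + 1)) * (\<sigma> (i + 1) - \<sigma> i) \<noteq> 0"
      "(\<sigma> (i + 1) - \<sigma> (i - 1)) * (\<sigma> (i - 1) - \<sigma> i) \<noteq> 0"
      unfolding sigi[OF i] using par(3)[OF i] par(4)[OF i]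
      by (simp_all flip: of_real_diff of_real_mult)
    show "of_nat (b_num G i) = complex_of_real H * (((\<sigma> (i - 1) - \<sigma> 1 * \<sigma> i) * (\<sigma> (i + 1) - \<epsilon> * \<sigma> i)) /
                    ((\<sigma> (i - 1) - \<sigma> (i + 1)) * (\<sigma> (i + 1) - \<sigma> i)))"
      unfolding sigi[OF i] sig \<epsilon>E cast conjunct2[OF par(3)[OF i]] by simp
    show "of_nat (c_num G i) = complex_of_real H * (((\<sigma> (i + 1) - \<sigma> 1 * \<sigma> i) * (\<sigma> (i - 1) - \<epsilon> * \<sigma> i)) /
                    ((\<sigma> (i + 1) - \<sigma> (i - 1)) * (\<sigma> (i - 1) - \<sigma> i)))"
      unfolding sigi[OF i] sig \<epsilon>E cast conjunct2[OF par(4)[OF i]] by simp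
  qed
  then show ?thesis by (rule that)
qed

text \<open>
  Nonbipartiteness excludes the eigenvalue \<open>- k\<close> and thereby the degenerate case in which the two
  sequences coincide.
\<close>

lemma parametrized_imp_tight:
  assumes bip: "\<not> drg_bipartite G" and d3: "3 \<le> d" and par: "parametrized \<sigma> \<epsilon> h"
  obtains \<theta> s where "tight G" "feasible_cosine_sequence G \<theta> s"
    "\<And>i. i \<le> d \<Longrightarrow> \<sigma> i = complex_of_real (s i)" "\<epsilon> = complex_of_real (auxiliary_parameter G \<theta>)"
proof -
  let ?K = "of_nat (valency G) :: complex"
  have p: "\<sigma> 0 = 1" "\<sigma> (d - 1) = \<sigma> 1 * \<sigma> d" "\<epsilon> \<noteq> - 1" "\<sigma> 1 - 1 \<noteq> 0"
      "?K = h * ((\<sigma> 1 - \<epsilon>) / (\<sigma> 1 - 1))" "of_nat (c_num G d) = ?K"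
    and pb: "\<And>i. i \<in> {1..d - 1} \<Longrightarrow> (\<sigma> (i - 1) - \<sigma> (i + 1)) * (\<sigma> (i + 1) - \<sigma> i) \<noteq> 0 \<and>
         of_nat (b_num G i) = h * (((\<sigma> (i - 1) - \<sigma> 1 * \<sigma> i) * (\<sigma> (i + 1) - \<epsilon> * \<sigma> i)) /
                    ((\<sigma> (i - 1) - \<sigma> (i + 1)) * (\<sigma> (i + 1) - \<sigma> i)))"
    and pc: "\<And>i. i \<in> {1..d - 1} \<Longrightarrow> (\<sigma> (i + 1) - \<sigma> (i - 1)) * (\<sigma> (i - 1) - \<sigma> i) \<noteq> 0 \<and>
         of_nat (c_num G i) = h * (((\<sigma> (i + 1) - \<sigma> 1 * \<sigma> i) * (\<sigma> (i - 1) - \<epsilon> * \<sigma> i)) /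
                    ((\<sigma> (i + 1) - \<sigma> (i - 1)) * (\<sigma> (i - 1) - \<sigma> i)))"
    using par unfolding parametrized_def by simp_all
  obtain \<rho> where \<sigma>3: "three_term (?K * \<sigma> 1) \<sigma>" and \<rho>3: "three_term (?K * \<rho> 1) \<rho>" "\<rho> 0 = 1"
    and \<rho>1: "\<rho> 1 * (\<sigma> 1 - \<epsilon>) = 1 - \<epsilon> * \<sigma> 1"
    and rel: "\<And>i. i < d \<Longrightarrow> \<rho> (Suc i) * (\<sigma> (Suc i) - \<epsilon> * \<sigma> i) = \<rho> i * (\<sigma> i - \<epsilon> * \<sigma> (Suc i))"
    by (rule parameters_sequences[OF refl p(1,2,4,5) pb pc p(6)]) (assumption | rule that)+
  define s r where "s = (\<lambda>i. Re (\<sigma> i))" and "r = (\<lambda>i. Re (\<rho> i))"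
  note real_\<sigma> = three_term_complex_real[OF \<sigma>3 p(1)] and real_\<rho> = three_term_complex_real[OF \<rho>3]
  have \<sigma>s: "\<sigma> i = complex_of_real (s i)" if "i \<le> d" for i
    using real_\<sigma>(2)[OF that] by (simp add: complex_eq_iff s_def)
  have \<rho>r: "\<rho> i = complex_of_real (r i)" if "i \<le> d" for i
    using real_\<rho>(2)[OF that] by (simp add: complex_eq_iff r_def)
  have at: "\<sigma> 1 = complex_of_real (s 1)" "\<sigma> 2 = complex_of_real (s 2)"
    "\<rho> 1 = complex_of_real (r 1)" "\<rho> 2 = complex_of_real (r 2)"
    using \<sigma>s \<rho>r diam_ge_2 by simp_all
  have s0: "s 0 = 1" and r0: "r 0 = 1" using p(1) \<rho>3(2) by (simp_all add: s_def r_def)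
  have s3: "three_term (k * s 1) s" using real_\<sigma>(3) by (simp add: s_def)
  have r3: "three_term (k * r 1) r" using real_\<rho>(3) by (simp add: r_def)
  have eig: "k * s 1 \<in> eigenvalues G" "k * r 1 \<in> eigenvalues G"
    by (rule three_term_eigenvalue[OF s3 s0], rule three_term_eigenvalue[OF r3 r0])
  have s1: "s 1 \<noteq> 1" using p(4) at(1) by auto
  have sm1: "s 1 \<noteq> - 1"
    using eigenvalue_neg_valency_bipartite bip eig(1) by auto
  have r1: "r 1 \<noteq> 1"
  proof
    assume "r 1 = 1"
    then have "(1 + \<epsilon>) * (\<sigma> 1 - 1) = 0" using \<rho>1 at(3) by (simp add: algebra_simps)
    then have "\<epsilon> + 1 = 0" using p(4) by (simp add: add.commute)
    then show False using p(3) by (simp add: eq_neg_iff_add_eq_0)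
  qed
  have eps: "\<epsilon> * (\<sigma> 1 - \<rho> 1) = 1 - \<sigma> 1 * \<rho> 1" using \<rho>1 by (simp add: algebra_simps)
  have sr: "s 1 \<noteq> r 1"
  proof
    assume "s 1 = r 1"
    then have "\<sigma> 1 * \<sigma> 1 = 1" using eps at(1,3) by simp
    then have "complex_of_real (s 1 * s 1) = complex_of_real 1" unfolding at(1) by simp
    then have "s 1 * s 1 = 1" unfolding of_real_eq_iff .
    then show False using s1 sm1 by (simp add: square_eq_1_iff)
  qed
  have \<epsilon>_eq: "\<epsilon> = complex_of_real ((1 - s 1 * r 1) / (s 1 - r 1))"
  proof -
    have "\<sigma> 1 - \<rho> 1 \<noteq> 0" using sr at(1,3) by simp
    then have "\<epsilon> = (1 - \<sigma> 1 * \<rho> 1) / (\<sigma> 1 - \<rho> 1)" using eps by (simp add: eq_divide_eq)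
    then show ?thesis unfolding at by simp
  qed
  have cross: "(s 1 - r 1) * (s 2 * r 2 - s 1 * r 1) = (1 - s 1 * r 1) * (s 1 * r 2 - s 2 * r 1)"
  proof -
    have "\<rho> 2 * (\<sigma> 2 - \<epsilon> * \<sigma> 1) = \<rho> 1 * (\<sigma> 1 - \<epsilon> * \<sigma> 2)"
      using rel[of 1] diam_ge_2 by (simp add: numeral_2_eq_2)
    then have "\<sigma> 2 * \<rho> 2 - \<sigma> 1 * \<rho> 1 = \<epsilon> * (\<sigma> 1 * \<rho> 2 - \<sigma> 2 * \<rho> 1)" by (simp add: algebra_simps)
    then have "(\<sigma> 1 - \<rho> 1) * (\<sigma> 2 * \<rho> 2 - \<sigma> 1 * \<rho> 1) = (\<epsilon> * (\<sigma> 1 - \<rho> 1)) * (\<sigma> 1 * \<rho> 2 - \<sigma> 2 * \<rho> 1)"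
      by simp
    then have "complex_of_real ((s 1 - r 1) * (s 2 * r 2 - s 1 * r 1))
        = complex_of_real ((1 - s 1 * r 1) * (s 1 * r 2 - s 2 * r 1))"
      unfolding eps unfolding at by simp
    then show ?thesis unfolding of_real_eq_iff .
  qed
  have T: "tight_form (s 1) (r 1) = 0"
    unfolding tight_form_def
    by (rule tight_form_from_relation[OF k_eq three_term_1[OF s3 s0] three_term_1[OF r3 r0] s1 r1 sr cross])
  note ext = extremal_pair[OF bip eig(1) s1 eig(2) r1 T]
  have tight: "tight G" unfolding tight_iff_form using d3 bip ext(1) by blast
  have comp: "complementary_eigenvalue G (k * s 1) = k * r 1"
    using ext(2) nth_eigenvalue_ends(1) unfolding complementary_eigenvalue_def by auto
  have "feasible_cosine_sequence G (k * s 1) s"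
    unfolding feasible_cosine_sequence_def
  proof (intro conjI ballI)
    show "cosine_sequence G (k * s 1) s" by (rule three_term_cosine_sequence[OF s3 s0])
    show "k * s 1 \<in> {nth_eigenvalue G 1, nth_eigenvalue G d}" using ext(2) by blast
    fix i assume i: "i \<in> {1..d - 1}"
    have "\<sigma> (i - 1) \<noteq> \<sigma> (i + 1)" using pb[OF i] by auto
    then show "s (i - 1) \<noteq> s (i + 1)" using \<sigma>s[of "i - 1"] \<sigma>s[of "i + 1"] i by auto
  qed (rule tight)
  moreover have "\<epsilon> = complex_of_real (auxiliary_parameter G (k * s 1))"
    unfolding auxiliary_parameter_cosines[OF refl comp] by (rule \<epsilon>_eq)
  ultimately show ?thesis using that tight \<sigma>s by blast
qed

lemma tight_iff_parametrized:
  assumes "\<not> drg_bipartite G" "3 \<le> d"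
  shows "(tight G \<and>
      (\<exists>\<theta> s. feasible_cosine_sequence G \<theta> s \<and>
             (\<forall>i\<le>d. \<sigma> i = complex_of_real (s i)) \<and>
             \<epsilon> = complex_of_real (auxiliary_parameter G \<theta>)) \<and>
      h = ((1 - \<sigma> 1) * (1 - \<sigma> 2)) / (((\<sigma> 1)\<^sup>2 - \<sigma> 2) * (1 - \<epsilon> * \<sigma> 1)))
     \<longleftrightarrow> parametrized \<sigma> \<epsilon> h" (is "?L \<longleftrightarrow> ?R")
proof
  assume L: ?L
  then obtain \<theta> s where s: "feasible_cosine_sequence G \<theta> s"
    "\<And>i. i \<le> d \<Longrightarrow> \<sigma> i = complex_of_real (s i)" "\<epsilon> = complex_of_real (auxiliary_parameter G \<theta>)"
    by blast
  obtain h' where h': "parametrized \<sigma> \<epsilon> h'"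
    using tight_imp_parametrized[OF conjunct1[OF L] s] by blast
  moreover have "h = h'" using parametrized_scale[OF h'] L by simp
  ultimately show ?R by simp
next
  assume R: ?R
  obtain \<theta> s where "tight G" "feasible_cosine_sequence G \<theta> s"
    "\<And>i. i \<le> d \<Longrightarrow> \<sigma> i = complex_of_real (s i)" "\<epsilon> = complex_of_real (auxiliary_parameter G \<theta>)"
    using parametrized_imp_tight[OF assms R] by blast
  then show ?L using parametrized_scale[OF R] by blast
qed

end

theorem theorem10p2:
  fixes G :: "('v::finite, 'e) pre_digraph"
    and d :: nat and k :: complex and b c :: "nat \<Rightarrow> complex"
    and \<sigma> :: "nat \<Rightarrow> complex" and \<epsilon> h :: complex
  assumes "verts G = UNIV"
    and "distance_regular G"
    and "\<not> drg_bipartite G"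
    and "d = graph_diameter G"
    and "d \<ge> 3"
    and "k = of_nat (valency G)"
    and "\<And>i. b i = of_nat (b_num G i)"
    and "\<And>i. c i = of_nat (c_num G i)"
  shows
    "(tight G \<and>
      (\<exists>\<theta> s. feasible_cosine_sequence G \<theta> s \<and>
             (\<forall>i\<le>d. \<sigma> i = complex_of_real (s i)) \<and>
             \<epsilon> = complex_of_real (auxiliary_parameter G \<theta>)) \<and>
      h = ((1 - \<sigma> 1) * (1 - \<sigma> 2)) / (((\<sigma> 1)\<^sup>2 - \<sigma> 2) * (1 - \<epsilon> * \<sigma> 1)))
     \<longleftrightarrow>
     (\<sigma> 0 = 1 \<and> \<sigma> (d - 1) = \<sigma> 1 * \<sigma> d \<and> \<epsilon> \<noteq> - 1 \<and>
      \<sigma> 1 - 1 \<noteq> 0 \<and>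
      k = h * ((\<sigma> 1 - \<epsilon>) / (\<sigma> 1 - 1)) \<and>
      (\<forall>i\<in>{1..d - 1}.
         (\<sigma> (i - 1) - \<sigma> (i + 1)) * (\<sigma> (i + 1) - \<sigma> i) \<noteq> 0 \<and>
         b i = h * (((\<sigma> (i - 1) - \<sigma> 1 * \<sigma> i) * (\<sigma> (i + 1) - \<epsilon> * \<sigma> i)) /
                    ((\<sigma> (i - 1) - \<sigma> (i + 1)) * (\<sigma> (i + 1) - \<sigma> i)))) \<and>
      (\<forall>i\<in>{1..d - 1}.
         (\<sigma> (i + 1) - \<sigma> (i - 1)) * (\<sigma> (i - 1) - \<sigma> i) \<noteq> 0 \<and>
         c i = h * (((\<sigma> (i + 1) - \<sigma> 1 * \<sigma> i) * (\<sigma> (i - 1) - \<epsilon> * \<sigma> i)) /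
                    ((\<sigma> (i + 1) - \<sigma> (i - 1)) * (\<sigma> (i - 1) - \<sigma> i)))) \<and>
      c d = h * ((\<sigma> 1 - \<epsilon>) / (\<sigma> 1 - 1)))"
proof -
  have "drg G" using assms(1,2,4,5) by (intro drg.intro) simp_all
  from drg.tight_iff_parametrized[OF this assms(3), of \<sigma> \<epsilon> h] assms(5)
  show ?thesis
    unfolding drg.parametrized_def[OF \<open>drg G\<close>] assms(4,6-8) by simp
qed

end
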